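(* Let $\nu_1,\nu_2\in(0,1)$. Let $\{S(t):t\geq 0\}$ be a real-valued Lévy process such that $\log\mathbb{E}[e^{\theta S(1)}]$ is finite in a neighborhood of $\theta=0$; assume that $\{S(t):t\geq 0\}$ has bounded variation and is not a subordinator. Let $\{S_1(t):t\geq 0\}$ and $\{S_2(t):t\geq 0\}$ be two non-null independent subordinators such that $\{S(t):t\geq 0\}$ is distributed as $\{S_1(t)-S_2(t):t\geq 0\}$, and let $\kappa_{S_i}(\theta):=\log\mathbb{E}[e^{\theta S_i(1)}]$ for $i=1,2$. Let $\{L_{\nu_1}^{(1)}(t):t\geq 0\}$ and $\{L_{\nu_2}^{(2)}(t):t\geq 0\}$ be two independent inverses of stable subordinators, of indices $\nu_1$ and $\nu_2$ respectively, independent of $\{(S_1(t),S_2(t)):t\geq 0\}$. Let $\Psi_{\nu_1,\nu_2}$ be the function defined by $$\Psi_{\nu_1,\nu_2}(\theta):=\begin{cases}(\kappa_{S_1}(\theta))^{1/\nu_1} & \text{if } \theta\geq 0,\\ (\kappa_{S_2}(-\theta))^{1/\nu_2} & \text{if } \theta<0.\end{cases}$$ Then $\left\{\frac{S_1(L_{\nu_1}^{(1)}(t))-S_2(L_{\nu_2}^{(2)}(t))}{t}:t>0\right\}$ satisfies the large deviation principle (as $t\to\infty$) with speed $v_t=t$ and good rate function $J_{\mathrm{LD}}$ defined by $$J_{\mathrm{LD}}(x):=\sup_{\theta\in\mathbb{R}}\{\theta x-\Psi_{\nu_1,\nu_2}(\theta)\}.$$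
   Context: A subordinator is a nondecreasing real-valued Lévy process; non-null means not identically zero. Under the stated assumptions on $S$ the functions $\kappa_{S_1},\kappa_{S_2}$ are finite in a neighborhood of the origin. They take values in $(-\infty,\infty]$, and $\infty^{1/\nu_i}=\infty$. Inverse of a stable subordinator: for $\nu\in(0,1)$, $L_\nu(t)=\inf\{u\geq 0: H_\nu(u)>t\}$, where $\{H_\nu(u):u\ge 0\}$ is the stable subordinator with $\mathbb{E}[e^{-\xi H_\nu(u)}]=e^{-u\xi^\nu}$ for $\xi\geq 0$. Its moment generating function is $\mathbb{E}[e^{\theta L_\nu(t)}]=E_\nu(\theta t^\nu)$ for all $\theta\in\mathbb{R}$, where $E_\nu(x):=\sum_{k=0}^\infty\frac{x^k}{\Gamma(\nu k+1)}$ is the Mittag-Leffler function. Large deviation principle (LDP): a family of real random variables $\{Z(t):t>0\}$ satisfies the LDP with speed $v_t\to\infty$ and rate function $I:\mathbb{R}\to[0,\infty]$ (lower semicontinuous) if $\limsup_{t\to\infty}\frac{1}{v_t}\log P(Z(t)\in C)\leq-\inf_{x\in C}I(x)$ for all closed sets $C$ and $\liminf_{t\to\infty}\frac{1}{v_t}\log P(Z(t)\in O)\geq-\inf_{x\in O}I(x)$ for all open sets $O$. The rate function $I$ is good if all level sets $\{x\in\mathbb{R}:I(x)\leq b\}$, $b\geq 0$, are compact. *)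

theory Defs
  imports "HOL-Probability.Probability"
begin

text \<open>
  A stochastic process on a probability space \<open>M\<close> is a function \<open>X :: real \<Rightarrow> 'a \<Rightarrow> real\<close>; only the
  times \<open>t \<ge> 0\<close> matter.  Path properties are required almost surely.
\<close>

definition sample_path :: "(real \<Rightarrow> 'a \<Rightarrow> real) \<Rightarrow> 'a \<Rightarrow> real \<Rightarrow> real" where
  "sample_path X \<omega> = (\<lambda>t\<in>{0..}. X t \<omega>)"

definition path_space :: "(real \<Rightarrow> real) measure" where
  "path_space = (\<Pi>\<^sub>M t\<in>{0..}. borel)"

text \<open>
  The law on the product space determines, and is determined by, the finite-dimensional
  distributions.
\<close>

definition process_law :: "'a measure \<Rightarrow> (real \<Rightarrow> 'a \<Rightarrow> real) \<Rightarrow> (real \<Rightarrow> real) measure" where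
  "process_law M X = distr M path_space (sample_path X)"

definition cadlag :: "(real \<Rightarrow> real) \<Rightarrow> bool" where
  "cadlag f \<longleftrightarrow> (\<forall>t\<ge>0. (f \<longlongrightarrow> f t) (at_right t)) \<and> (\<forall>t>0. \<exists>l. (f \<longlongrightarrow> l) (at_left t))"

text \<open>
  Continuity in probability need not be listed: it follows from the cadlag paths together with the
  stationarity of the increments.
\<close>

definition levy_process :: "'a measure \<Rightarrow> (real \<Rightarrow> 'a \<Rightarrow> real) \<Rightarrow> bool" where
  "levy_process M X \<longleftrightarrow>
     (\<forall>t\<ge>0. X t \<in> borel_measurable M) \<and>
     (AE \<omega> in M. X 0 \<omega> = 0) \<and>
     (\<forall>n (\<tau> :: nat \<Rightarrow> real). 0 \<le> \<tau> 0 \<and> (\<forall>i<n. \<tau> i \<le> \<tau> (Suc i)) \<longrightarrow>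
        prob_space.indep_vars M (\<lambda>_. borel) (\<lambda>i \<omega>. X (\<tau> (Suc i)) \<omega> - X (\<tau> i) \<omega>) {..<n}) \<and>
     (\<forall>s\<ge>0. \<forall>t\<ge>0. distr M borel (\<lambda>\<omega>. X (s + t) \<omega> - X s \<omega>) = distr M borel (X t)) \<and>
     (AE \<omega> in M. cadlag (\<lambda>t. X t \<omega>))"

definition subordinator :: "'a measure \<Rightarrow> (real \<Rightarrow> 'a \<Rightarrow> real) \<Rightarrow> bool" where
  "subordinator M X \<longleftrightarrow> levy_process M X \<and> (AE \<omega> in M. mono_on {0..} (\<lambda>t. X t \<omega>))"

definition null_process :: "'a measure \<Rightarrow> (real \<Rightarrow> 'a \<Rightarrow> real) \<Rightarrow> bool" where
  "null_process M X \<longleftrightarrow> (AE \<omega> in M. \<forall>t\<ge>0. X t \<omega> = 0)"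

definition bounded_variation_on :: "real \<Rightarrow> real \<Rightarrow> (real \<Rightarrow> real) \<Rightarrow> bool" where
  "bounded_variation_on a b f \<longleftrightarrow>
     (\<exists>B. \<forall>n (\<tau> :: nat \<Rightarrow> real). a \<le> \<tau> 0 \<and> (\<forall>i<n. \<tau> i \<le> \<tau> (Suc i)) \<and> \<tau> n \<le> b \<longrightarrow>
        (\<Sum>i<n. \<bar>f (\<tau> (Suc i)) - f (\<tau> i)\<bar>) \<le> B)"

definition bounded_variation_process :: "'a measure \<Rightarrow> (real \<Rightarrow> 'a \<Rightarrow> real) \<Rightarrow> bool" where
  "bounded_variation_process M X \<longleftrightarrow>
     (AE \<omega> in M. \<forall>T\<ge>0. bounded_variation_on 0 T (\<lambda>t. X t \<omega>))"

definition stable_subordinator :: "'a measure \<Rightarrow> real \<Rightarrow> (real \<Rightarrow> 'a \<Rightarrow> real) \<Rightarrow> bool" where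
  "stable_subordinator M \<nu> H \<longleftrightarrow> subordinator M H \<and>
     (\<forall>u\<ge>0. \<forall>\<xi>\<ge>0. (\<integral>\<omega>. exp (- \<xi> * H u \<omega>) \<partial>M) = exp (- u * \<xi> powr \<nu>))"

text \<open>
  Almost surely \<open>H\<close> is unbounded, so the infimum is over a nonempty set; the value of the real
  \<open>Inf {}\<close> plays no role.
\<close>

definition inverse_stable_subordinator ::
    "'a measure \<Rightarrow> real \<Rightarrow> (real \<Rightarrow> 'a \<Rightarrow> real) \<Rightarrow> bool" where
  "inverse_stable_subordinator M \<nu> L \<longleftrightarrow>
     (\<exists>H. stable_subordinator M \<nu> H \<and>
       (AE \<omega> in M. \<forall>t\<ge>0. L t \<omega> = Inf {u. 0 \<le> u \<and> H u \<omega> > t}))"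

definition log_ennreal :: "ennreal \<Rightarrow> ereal" where
  "log_ennreal x =
     (if x = 0 then -\<infinity> else if x = \<infinity> then \<infinity> else ereal (ln (enn2real x)))"

text \<open>
  The expectation is a nonnegative integral, so that the value \<open>\<infinity>\<close> is attained where the moment
  generating function diverges.
\<close>

definition log_mgf :: "'a measure \<Rightarrow> ('a \<Rightarrow> real) \<Rightarrow> real \<Rightarrow> ereal" where
  "log_mgf M Y \<theta> = log_ennreal (\<integral>\<^sup>+\<omega>. ennreal (exp (\<theta> * Y \<omega>)) \<partial>M)"

text \<open>Only meant for nonnegative bases and positive exponents.\<close>

definition ereal_powr :: "ereal \<Rightarrow> real \<Rightarrow> ereal" where
  "ereal_powr x p = (if x = \<infinity> then \<infinity> else ereal (real_of_ereal x powr p))"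

definition Psi ::
    "real \<Rightarrow> real \<Rightarrow> (real \<Rightarrow> ereal) \<Rightarrow> (real \<Rightarrow> ereal) \<Rightarrow> real \<Rightarrow> ereal" where
  "Psi \<nu>\<^sub>1 \<nu>\<^sub>2 \<kappa>\<^sub>1 \<kappa>\<^sub>2 \<theta> =
     (if \<theta> \<ge> 0 then ereal_powr (\<kappa>\<^sub>1 \<theta>) (1 / \<nu>\<^sub>1) else ereal_powr (\<kappa>\<^sub>2 (- \<theta>)) (1 / \<nu>\<^sub>2))"

definition legendre_transform :: "(real \<Rightarrow> ereal) \<Rightarrow> real \<Rightarrow> ereal" where
  "legendre_transform \<Lambda> x = (SUP \<theta>. ereal (\<theta> * x) - \<Lambda> \<theta>)"

text \<open>Lower semicontinuity is expressed by closed sublevel sets.\<close>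

definition rate_function :: "(real \<Rightarrow> ereal) \<Rightarrow> bool" where
  "rate_function I \<longleftrightarrow> (\<forall>x. 0 \<le> I x) \<and> (\<forall>b::real. closed {x. I x \<le> ereal b})"

definition good_rate_function :: "(real \<Rightarrow> ereal) \<Rightarrow> bool" where
  "good_rate_function I \<longleftrightarrow> rate_function I \<and> (\<forall>b::real. b \<ge> 0 \<longrightarrow> compact {x. I x \<le> ereal b})"

definition satisfies_LDP ::
    "'a measure \<Rightarrow> (real \<Rightarrow> 'a \<Rightarrow> real) \<Rightarrow> (real \<Rightarrow> real) \<Rightarrow> (real \<Rightarrow> ereal) \<Rightarrow> bool" where
  "satisfies_LDP M Z v I \<longleftrightarrow>
     (\<forall>t>0. Z t \<in> borel_measurable M) \<and>
     filterlim v at_top at_top \<and>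
     rate_function I \<and>
     (\<forall>C. closed C \<longrightarrow>
        Limsup at_top (\<lambda>t. ereal (1 / v t) * log_ennreal (emeasure M {\<omega> \<in> space M. Z t \<omega> \<in> C}))
          \<le> - (INF x\<in>C. I x)) \<and>
     (\<forall>U. open U \<longrightarrow>
        Liminf at_top (\<lambda>t. ereal (1 / v t) * log_ennreal (emeasure M {\<omega> \<in> space M. Z t \<omega> \<in> U}))
          \<ge> - (INF x\<in>U. I x))"

text \<open>
  Path properties only hold almost surely, so a time-changed process such as
  \<open>S\<^sub>1 (L\<^sub>1 t \<omega>) \<omega>\<close> agrees with a random variable only up to a null set and need not be measurable
  on \<open>M\<close> itself.  It is measurable on \<open>completion M\<close>, and large deviations of such processes are to
  be stated there; \<open>completion M\<close> agrees with \<open>M\<close> on the events of \<open>M\<close>.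
\<close>

end

theory Submission
  imports Defs
begin

text \<open>
  Write \<open>A t = S1 (L1 t)\<close> and \<open>B t = S2 (L2 t)\<close>.  Both are nonnegative and independent, and the rate
  function splits at \<open>0\<close>: for \<open>x \<ge> 0\<close> only \<open>\<theta> \<ge> 0\<close> matters in the supremum, so that \<open>J x\<close> is the
  rate of \<open>A t \<ge> x t\<close>, and for \<open>x \<le> 0\<close> it is the rate of \<open>B t \<ge> - x t\<close>.  As these one-sided rates are
  strictly increasing in \<open>\<bar>x\<bar>\<close>, tail asymptotics of \<open>A\<close> and \<open>B\<close> suffice for the whole principle.

  The function \<open>\<Psi>\<close> need not be steep at the ends of its domain, so a change of measure is not
  available in general.  Instead the proof rests on two observations about one summand, say
  \<open>S (L t)\<close> with \<open>L\<close> the inverse of the stable subordinator \<open>H\<close>.  Call a pair \<open>(\<theta>, \<xi>)\<close>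
  of nonnegative numbers admissible
  if \<open>E exp (\<theta> S 1) \<le> exp (\<xi>\<^sup>\<nu>)\<close>, that is, \<open>\<kappa>\<^sub>S \<theta>\<close> to the power \<open>1 / \<nu>\<close> is at most \<open>\<xi>\<close>.

  \<^item> Upper bound (\<open>chernoff\<close>).  Since \<open>S\<close> is nondecreasing, \<open>exp (\<theta> S (L t))\<close> is at most the sum over
    \<open>j\<close> of \<open>exp (\<theta> S (j + 1))\<close> on \<open>L t \<ge> j\<close>, and \<open>L t > j\<close> forces \<open>H j \<le> t\<close>, which has probability at
    most \<open>exp (\<xi> t - j \<xi>\<^sup>\<nu>)\<close>.  The sum is geometric and of order \<open>exp (\<xi> t)\<close>.

  \<^item> Lower bound (\<open>time_change_lower_tail\<close>).  The event \<open>H n \<le> t\<close> forces \<open>L t \<ge> n\<close>, so that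
    \<open>S (L t) \<ge> x t\<close> has at least the probability \<open>F n (x t) t\<close>, where
    \<open>F n x y = P (S n \<ge> x) P (H n \<le> y)\<close>.  Independent increments make \<open>F\<close> supermultiplicative in all
    three arguments.  The best exponent \<open>g x\<close> of \<open>F n (x y) y\<close> over all \<open>n\<close> and \<open>y\<close> is therefore concave
    in \<open>x\<close> and has a supporting line at every \<open>x0\<close>: \<open>F n x y \<le> exp (\<xi> y - \<theta> x)\<close> for all \<open>n, x, y\<close>, with
    \<open>g x0 = \<xi> - \<theta> x0\<close> (\<open>supporting_line\<close>).  Inserting these bounds on the tails into
    \<open>E exp (\<theta>' S n) E exp (- \<xi>' H n)\<close> for \<open>\<theta>' < \<theta>\<close> and \<open>\<xi>' > \<xi>\<close> bounds the \<open>n\<close>-th power of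
    \<open>E exp (\<theta>' S 1) exp (- \<xi>'\<^sup>\<nu>)\<close> uniformly in \<open>n\<close>; hence \<open>(\<theta>', \<xi>')\<close> is admissible
    (\<open>admissible_if_tail_product_le\<close>) and the exponent reached is at least \<open>- J x0\<close>.
\<close>

section \<open>Exponential rates of probabilities\<close>

lemma log_ennreal_mono:
  assumes "a \<le> b"
  shows "log_ennreal a \<le> log_ennreal b"
proof -
  consider "a = 0" | "b = \<infinity>" | "a \<noteq> 0" "b \<noteq> \<infinity>" by auto
  then show ?thesis
  proof cases
    case 3
    then have "a \<noteq> \<infinity>" "b \<noteq> 0" using assms by (auto simp: top_unique)
    moreover have "enn2real a \<le> enn2real b" "0 < enn2real a"
      using 3 assms \<open>a \<noteq> \<infinity>\<close> by (auto intro!: enn2real_mono simp: enn2real_positive_iff less_top zero_less_iff_neq_zero)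
    ultimately show ?thesis using 3 by (auto simp: log_ennreal_def)
  qed (use assms in \<open>auto simp: log_ennreal_def\<close>)
qed

lemma log_ennreal_ennreal: "0 < r \<Longrightarrow> log_ennreal (ennreal r) = ereal (ln r)"
  by (simp add: log_ennreal_def)

text \<open>
  Testing the rate against real numbers \<open>c\<close> below it, instead of handling its value, covers
  infinite rates (empty closed sets) as well.
\<close>

lemma limsup_log_le:
  fixes p :: "real \<Rightarrow> ennreal" and I :: ereal
  assumes "0 \<le> I"
    and decay: "\<And>c. ereal c < I \<Longrightarrow> \<exists>K. \<forall>t>0. p t \<le> ennreal (K * exp (- c * t))"
  shows "Limsup at_top (\<lambda>t. ereal (1 / t) * log_ennreal (p t)) \<le> - I"
proof -
  have bound: "Limsup at_top (\<lambda>t. ereal (1 / t) * log_ennreal (p t)) \<le> ereal (- c)" if c: "ereal c < I" for c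
  proof -
    obtain K where K: "\<And>t. 0 < t \<Longrightarrow> p t \<le> ennreal (K * exp (- c * t))" using decay[OF c] by blast
    define K' where "K' = max K 1"
    have "ereal (1 / t) * log_ennreal (p t) \<le> ereal (ln K' / t - c)" if t: "0 < t" for t
    proof -
      have "p t \<le> ennreal (K' * exp (- c * t))"
        using K[OF t] by (rule order_trans) (auto intro!: ennreal_leI simp: K'_def)
      then have "log_ennreal (p t) \<le> log_ennreal (ennreal (K' * exp (- c * t)))" by (rule log_ennreal_mono)
      also have "\<dots> = ereal (ln K' - c * t)"
        by (subst log_ennreal_ennreal) (auto simp: K'_def ln_mult)
      finally have "ereal (1 / t) * log_ennreal (p t) \<le> ereal (1 / t) * ereal (ln K' - c * t)"
        using t by (intro ereal_mult_left_mono) auto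
      also have "ereal (1 / t) * ereal (ln K' - c * t) = ereal (ln K' / t - c)"
        using t by (simp add: diff_divide_distrib)
      finally show ?thesis .
    qed
    then have "eventually (\<lambda>t. ereal (1 / t) * log_ennreal (p t) \<le> ereal (ln K' / t - c)) at_top"
      using eventually_gt_at_top[of 0] by (rule eventually_mono[rotated])
    then have "Limsup at_top (\<lambda>t. ereal (1 / t) * log_ennreal (p t)) \<le> Limsup at_top (\<lambda>t. ereal (ln K' / t - c))"
      by (rule Limsup_mono)
    also have "\<dots> = ereal (- c)"
    proof (rule lim_imp_Limsup)
      have "((\<lambda>t. ln K' / t - c) \<longlongrightarrow> 0 - c) at_top"
        by (intro tendsto_diff tendsto_const tendsto_divide_0[OF tendsto_const] filterlim_at_top_imp_at_infinity filterlim_ident)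
      then show "((\<lambda>t. ereal (ln K' / t - c)) \<longlongrightarrow> ereal (- c)) at_top" by simp
    qed simp
    finally show ?thesis .
  qed
  have *: "ereal c \<le> - Limsup at_top (\<lambda>t. ereal (1 / t) * log_ennreal (p t))" if "ereal c < I" for c
    using iffD2[OF ereal_minus_le_minus bound[OF that]] by simp
  have "I \<le> - Limsup at_top (\<lambda>t. ereal (1 / t) * log_ennreal (p t))"
  proof (rule ccontr)
    assume "\<not> ?thesis"
    then obtain c where "- Limsup at_top (\<lambda>t. ereal (1 / t) * log_ennreal (p t)) < ereal c" "ereal c < I"
      by (meson ereal_dense2 linorder_not_le)
    with *[of c] show False by simp
  qed
  from iffD2[OF ereal_minus_le_minus this] show ?thesis by simp
qed

lemma liminf_log_ge:
  fixes p :: "real \<Rightarrow> ennreal" and I :: ereal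
  assumes "\<And>c. I < ereal c \<Longrightarrow> eventually (\<lambda>t. ennreal (exp (- c * t)) \<le> p t) at_top"
  shows "- I \<le> Liminf at_top (\<lambda>t. ereal (1 / t) * log_ennreal (p t))"
proof -
  let ?l = "Liminf at_top (\<lambda>t. ereal (1 / t) * log_ennreal (p t))"
  have *: "- ?l \<le> ereal c" if c: "I < ereal c" for c
  proof -
    have "eventually (\<lambda>t. ereal (- c) \<le> ereal (1 / t) * log_ennreal (p t)) at_top"
      using assms[OF c] eventually_gt_at_top[of 0]
    proof eventually_elim
      case (elim t)
      have "ereal (- c * t) \<le> log_ennreal (p t)"
        using log_ennreal_mono[OF elim(1)] by (simp only: log_ennreal_ennreal ln_exp exp_gt_zero)
      then have "ereal (1 / t) * ereal (- c * t) \<le> ereal (1 / t) * log_ennreal (p t)"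
        using elim by (intro ereal_mult_left_mono) auto
      then show ?case using elim by simp
    qed
    then have "ereal (- c) \<le> ?l" by (rule Liminf_bounded)
    from iffD2[OF ereal_minus_le_minus this] show ?thesis by simp
  qed
  have "- ?l \<le> I"
  proof (rule ccontr)
    assume "\<not> ?thesis"
    then obtain c where "I < ereal c" "ereal c < - ?l"
      by (meson ereal_dense2 linorder_not_le)
    with *[of c] show False by simp
  qed
  from iffD2[OF ereal_minus_le_minus this] show ?thesis by simp
qed

lemma eventually_exp_small:
  fixes c K \<epsilon> :: real
  assumes "0 < c" "0 < \<epsilon>"
  shows "eventually (\<lambda>t. K * exp (- c * t) \<le> \<epsilon>) at_top"
proof -
  have "((\<lambda>t. K * exp (- c * t)) \<longlongrightarrow> 0) at_top" using assms(1) by real_asymp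
  then have "eventually (\<lambda>t. K * exp (- c * t) < \<epsilon>) at_top" using assms(2) by (rule order_tendstoD)
  then show ?thesis by (auto elim: eventually_mono)
qed

lemma suminf_ennreal_geometric:
  assumes "0 \<le> a" "0 \<le> q" "q < 1"
  shows "(\<Sum>j. ennreal (a * q ^ j)) = ennreal (a / (1 - q))"
proof -
  have "(\<lambda>j. a * q ^ j) sums (a * (1 / (1 - q)))"
    using assms by (intro sums_mult geometric_sums) auto
  then show ?thesis using assms by (subst suminf_ennreal_eq) auto
qed

section \<open>Supporting lines of supermultiplicative families\<close>

lemma supermultiplicative_power:
  fixes F :: "nat \<Rightarrow> real \<Rightarrow> real \<Rightarrow> real"
  assumes nonneg: "\<And>n x y. 0 \<le> F n x y"
    and super: "\<And>n m x x' y y'. 0 \<le> x \<Longrightarrow> 0 \<le> x' \<Longrightarrow> 0 < y \<Longrightarrow> 0 < y' \<Longrightarrow>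
                  F n x y * F m x' y' \<le> F (n + m) (x + x') (y + y')"
    and "0 \<le> x" "0 < y" "0 < N"
  shows "F n x y ^ N \<le> F (N * n) (real N * x) (real N * y)"
  using \<open>0 < N\<close>
proof (induction N rule: nat_induct_non_zero)
  case 1
  then show ?case by simp
next
  case (Suc N)
  have "F n x y ^ Suc N \<le> F n x y * F (N * n) (real N * x) (real N * y)"
    using Suc nonneg by (simp add: mult_left_mono)
  also have "\<dots> \<le> F (n + N * n) (x + real N * x) (y + real N * y)"
    using assms Suc by (intro super) auto
  finally show ?case by (simp add: algebra_simps)
qed

text \<open>
  Consider the cone of points \<open>(x, y, l)\<close> with \<open>l \<le> ln (F n x y)\<close> for some \<open>n\<close>.  Supermultiplicativity
  makes it closed under addition, so the best value \<open>g\<close> of \<open>ln (F n (x0 y) y) / y\<close> on the ray through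
  \<open>(x0, 1)\<close> admits a linear majorant that is attained on that ray.  Its slope is found as usual for a
  concave function: the difference quotients from one side of the ray never exceed those from the
  other side, as a violation could be combined, with integer multiples, to a point on the ray above
  \<open>g\<close>.  Monotonicity in \<open>x\<close> absorbs the rounding to integers.
\<close>

lemma supporting_line:
  fixes F :: "nat \<Rightarrow> real \<Rightarrow> real \<Rightarrow> real"
  assumes nonneg: "\<And>n x y. 0 \<le> F n x y"
    and le_1: "\<And>n x y. F n x y \<le> 1"
    and super: "\<And>n m x x' y y'. 0 \<le> x \<Longrightarrow> 0 \<le> x' \<Longrightarrow> 0 < y \<Longrightarrow> 0 < y' \<Longrightarrow>
                  F n x y * F m x' y' \<le> F (n + m) (x + x') (y + y')"
    and anti: "\<And>n x x' y. x \<le> x' \<Longrightarrow> F n x' y \<le> F n x y"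
    and unit: "F 0 0 1 = 1"
    and "0 < x0" "x0 < z" "0 < F k z 1"
  obtains \<theta> \<xi> where "0 \<le> \<theta>" "0 \<le> \<xi>"
    "\<And>n x y. 0 \<le> x \<Longrightarrow> 0 < y \<Longrightarrow> F n x y \<le> exp (\<xi> * y - \<theta> * x)"
    "\<And>\<epsilon>. 0 < \<epsilon> \<Longrightarrow> \<exists>n. \<exists>y>0. exp (y * (\<xi> - \<theta> * x0 - \<epsilon>)) \<le> F n (x0 * y) y"
proof -
  define G where "G = {ln (F n (x0 * y) y) / y | n y. 0 < y \<and> 0 < F n (x0 * y) y}"
  define g where "g = Sup G"
  have G_le: "v \<le> 0" if "v \<in> G" for v
    using that le_1 by (auto simp: G_def divide_le_0_iff)
  have "0 < F k x0 1" using anti[of x0 z k 1] assms(6-8) by linarith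
  then have "ln (F k (x0 * 1) 1) / 1 \<in> G"
    unfolding G_def by (intro CollectI exI[of _ k] exI[of _ "1::real"]) simp
  then have G_ne: "G \<noteq> {}" by blast
  have G_bdd: "bdd_above G" using G_le by (meson bdd_above.I)
  have on_ray: "ln (F n (x0 * y) y) \<le> g * y" if "0 < y" "0 < F n (x0 * y) y" for n y
  proof -
    have "ln (F n (x0 * y) y) / y \<in> G" using that by (auto simp: G_def)
    then have "ln (F n (x0 * y) y) / y \<le> g" unfolding g_def using G_bdd by (rule cSup_upper)
    then show ?thesis using that by (simp add: divide_le_eq)
  qed
  have above_ray: "ln (F n x y) \<le> g * y" if "0 < y" "x0 * y \<le> x" "0 < F n x y" for n x y
  proof -
    have "F n x y \<le> F n (x0 * y) y" using that by (intro anti)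
    then show ?thesis using on_ray[of y n] that by (smt (verit) ln_le_cancel_iff)
  qed
  define Sl where "Sl = {(g * y - ln (F n x y)) / (x - x0 * y) | n x y. 0 < y \<and> x0 * y < x \<and> 0 < F n x y}"
  define \<theta> where "\<theta> = Inf Sl"
  have Sl_ge: "0 \<le> v" if "v \<in> Sl" for v
    using that by (auto simp: Sl_def intro!: divide_nonneg_pos above_ray)
  have "(g * 1 - ln (F k z 1)) / (z - x0 * 1) \<in> Sl"
    unfolding Sl_def using assms(6-8)
    by (intro CollectI exI[of _ k] exI[of _ z] exI[of _ "1::real"]) simp
  then have Sl_ne: "Sl \<noteq> {}" by blast
  have Sl_bdd: "bdd_below Sl" using Sl_ge by (meson bdd_below.I)
  have \<theta>: "0 \<le> \<theta>" unfolding \<theta>_def using Sl_ne Sl_ge by (rule cInf_greatest)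
  have slopes: "(ln (F n1 x1 y1) - g * y1) / (x0 * y1 - x1) \<le> (g * y2 - ln (F n2 x2 y2)) / (x2 - x0 * y2)"
    if 1: "0 \<le> x1" "0 < y1" "x1 < x0 * y1" "0 < F n1 x1 y1"
      and 2: "0 < y2" "x0 * y2 < x2" "0 < F n2 x2 y2" for n1 x1 y1 n2 x2 y2
  proof (rule ccontr)
    define a where "a = ln (F n1 x1 y1) - g * y1"
    define b where "b = g * y2 - ln (F n2 x2 y2)"
    define d where "d = x0 * y1 - x1"
    define e where "e = x2 - x0 * y2"
    have pos: "0 < d" "0 < e" using 1 2 by (auto simp: d_def e_def)
    have "0 \<le> x2" using 2 \<open>0 < x0\<close> by (smt (verit) mult_pos_pos)
    have b: "0 \<le> b" using above_ray[of y2 x2 n2] 2 by (simp add: b_def)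
    assume "\<not> ?thesis"
    then have "b / e < a / d" by (simp add: a_def b_def d_def e_def)
    then have pos_gap: "0 < a - b * d / e" using pos by (simp add: field_simps)
    obtain N0 :: nat where "b / (a - b * d / e) < real N0" using reals_Archimedean2 by blast
    then have N0: "b < real N0 * (a - b * d / e)" using pos_gap by (simp add: divide_less_eq)
    (* Take N1 copies of the point left of the ray and N2 copies of the one right of it.  N2 is the
       least number that brings the sum to the ray or beyond it; N1 is so large that the excess, less
       than one copy, does not spoil the inequality. *)
    define N1 where "N1 = Suc N0"
    have "real N1 * (a - b * d / e) = real N0 * (a - b * d / e) + (a - b * d / e)"
      by (simp add: N1_def distrib_right)
    then have N1: "b < real N1 * (a - b * d / e)" "0 < N1"
      using N0 pos_gap by (auto simp: N1_def)
    define N2 where "N2 = nat \<lceil>real N1 * d / e\<rceil>"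
    have q: "0 < real N1 * d / e" using N1 pos by simp
    then have N2: "0 < N2" "real N1 * d / e \<le> real N2" "real N2 < real N1 * d / e + 1"
      unfolding N2_def by linarith+
    have "real N1 * d \<le> real N2 * e" using N2(2) pos by (simp add: divide_le_eq)
    then have beyond: "x0 * (real N1 * y1 + real N2 * y2) \<le> real N1 * x1 + real N2 * x2"
      by (simp add: d_def e_def algebra_simps)
    have "F n1 x1 y1 ^ N1 * F n2 x2 y2 ^ N2
        \<le> F (N1 * n1) (real N1 * x1) (real N1 * y1) * F (N2 * n2) (real N2 * x2) (real N2 * y2)"
      using 1 2 N1 N2 \<open>0 \<le> x2\<close> nonneg super
      by (intro mult_mono supermultiplicative_power) auto
    also have "\<dots> \<le> F (N1 * n1 + N2 * n2) (real N1 * x1 + real N2 * x2) (real N1 * y1 + real N2 * y2)"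
      using 1 2 N1 N2 \<open>0 \<le> x2\<close> by (intro super) auto
    finally have prod: "F n1 x1 y1 ^ N1 * F n2 x2 y2 ^ N2 \<le> \<dots>" .
    have prod_pos: "0 < F n1 x1 y1 ^ N1 * F n2 x2 y2 ^ N2" using 1 2 by simp
    have "real N1 * ln (F n1 x1 y1) + real N2 * ln (F n2 x2 y2) = ln (F n1 x1 y1 ^ N1 * F n2 x2 y2 ^ N2)"
      using 1 2 by (simp add: ln_mult ln_realpow)
    also have "\<dots> \<le> ln (F (N1 * n1 + N2 * n2) (real N1 * x1 + real N2 * x2) (real N1 * y1 + real N2 * y2))"
      using prod prod_pos by simp
    also have "\<dots> \<le> g * (real N1 * y1 + real N2 * y2)"
      using 1 2 N1 beyond order_less_le_trans[OF prod_pos prod]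
      by (intro above_ray) (auto intro: add_pos_nonneg)
    finally have "real N1 * a \<le> real N2 * b" by (simp add: a_def b_def algebra_simps)
    also have "\<dots> \<le> (real N1 * d / e + 1) * b" using N2 b by (intro mult_right_mono) auto
    finally show False using N1 by (simp add: algebra_simps)
  qed
  define \<xi> where "\<xi> = g + \<theta> * x0"
  have line: "F n x y \<le> exp (\<xi> * y - \<theta> * x)" if xy: "0 \<le> x" "0 < y" for n x y
  proof (cases "0 < F n x y")
    case True
    have "ln (F n x y) \<le> g * y + \<theta> * (x0 * y - x)"
    proof (cases x "x0 * y" rule: linorder_cases)
      case less
      have "(ln (F n x y) - g * y) / (x0 * y - x) \<le> \<theta>"
        unfolding \<theta>_def
      proof (rule cInf_greatest[OF Sl_ne])
        fix v assume "v \<in> Sl"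
        then show "(ln (F n x y) - g * y) / (x0 * y - x) \<le> v"
          unfolding Sl_def using slopes[OF xy less True] by blast
      qed
      then show ?thesis using less by (simp add: divide_le_eq algebra_simps)
    next
      case equal
      then show ?thesis using on_ray[of y n] True xy by simp
    next
      case greater
      then have "(g * y - ln (F n x y)) / (x - x0 * y) \<in> Sl"
        unfolding Sl_def using True xy by blast
      then have "\<theta> \<le> (g * y - ln (F n x y)) / (x - x0 * y)"
        unfolding \<theta>_def using Sl_bdd by (intro cInf_lower)
      then show ?thesis using greater by (simp add: le_divide_eq algebra_simps)
    qed
    then have "ln (F n x y) \<le> \<xi> * y - \<theta> * x" by (simp add: \<xi>_def algebra_simps)
    then show ?thesis using True by (metis exp_le_cancel_iff exp_ln)
  next
    case False
    then show ?thesis using nonneg[of n x y] by (smt (verit) exp_gt_zero)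
  qed
  have "0 \<le> \<xi>" using line[of 0 1 0] unit by simp
  moreover have "\<exists>n. \<exists>y>0. exp (y * (\<xi> - \<theta> * x0 - \<epsilon>)) \<le> F n (x0 * y) y" if \<epsilon>: "0 < \<epsilon>" for \<epsilon>
  proof -
    obtain v where "v \<in> G" "g - \<epsilon> < v"
      using less_cSup_iff[OF G_ne G_bdd, of "g - \<epsilon>"] \<epsilon> by (auto simp: g_def)
    then obtain n y where ny: "0 < y" "0 < F n (x0 * y) y" "g - \<epsilon> < ln (F n (x0 * y) y) / y"
      by (auto simp: G_def)
    then have "y * (\<xi> - \<theta> * x0 - \<epsilon>) \<le> ln (F n (x0 * y) y)"
      by (simp add: \<xi>_def less_divide_eq algebra_simps)
    then show ?thesis using ny by (metis exp_le_cancel_iff exp_ln)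
  qed
  ultimately show ?thesis using that \<theta> line by blast
qed

section \<open>Increments and paths of Levy processes\<close>

lemma (in prob_space) nn_integral_mult_indep:
  fixes f g :: "'b \<Rightarrow> ennreal"
  assumes indep: "indep_var A X B Y"
    and f: "f \<in> borel_measurable A" and g: "g \<in> borel_measurable B"
  shows "(\<integral>\<^sup>+\<omega>. f (X \<omega>) * g (Y \<omega>) \<partial>M) = (\<integral>\<^sup>+\<omega>. f (X \<omega>) \<partial>M) * (\<integral>\<^sup>+\<omega>. g (Y \<omega>) \<partial>M)"
proof -
  have "indep_var borel (f \<circ> X) borel (g \<circ> Y)" using indep f g by (rule indep_var_compose)
  then have "indep_vars (\<lambda>_. borel) (case_bool (f \<circ> X) (g \<circ> Y)) UNIV"
    unfolding indep_var_def by (rule iffD1[OF indep_vars_cong, rotated -1]) (auto split: bool.split)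
  from indep_vars_nn_integral[OF _ this] show ?thesis by (simp add: UNIV_bool comp_def mult.commute)
qed

lemma (in prob_space) nn_integral_increments:
  fixes f g :: "real \<Rightarrow> ennreal"
  assumes X: "levy_process M X" and st: "0 \<le> s" "0 \<le> t"
    and [measurable]: "f \<in> borel_measurable borel" "g \<in> borel_measurable borel"
  shows "(\<integral>\<^sup>+\<omega>. f (X s \<omega>) * g (X (s + t) \<omega> - X s \<omega>) \<partial>M) = (\<integral>\<^sup>+\<omega>. f (X s \<omega>) \<partial>M) * (\<integral>\<^sup>+\<omega>. g (X t \<omega>) \<partial>M)"
proof -
  have [measurable]: "X s \<in> borel_measurable M" "X t \<in> borel_measurable M" "X (s + t) \<in> borel_measurable M"
    using X st by (auto simp: levy_process_def)
  have X0: "AE \<omega> in M. X 0 \<omega> = 0" using X by (simp add: levy_process_def)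
  (* The first increment is X s - X 0, which equals X s almost surely. *)
  define \<tau> :: "nat \<Rightarrow> real" where "\<tau> i = (if i = 0 then 0 else if i = 1 then s else s + t)" for i
  define h where "h i = (if i = (0::nat) then f else g)" for i
  have "indep_vars (\<lambda>_. borel) (\<lambda>i \<omega>. X (\<tau> (Suc i)) \<omega> - X (\<tau> i) \<omega>) {..<2}"
  proof -
    have "0 \<le> \<tau> 0 \<and> (\<forall>i<2. \<tau> i \<le> \<tau> (Suc i))" using st by (auto simp: \<tau>_def)
    then show ?thesis using X unfolding levy_process_def by blast
  qed
  then have ind: "indep_vars (\<lambda>_. borel) (\<lambda>i \<omega>. h i (X (\<tau> (Suc i)) \<omega> - X (\<tau> i) \<omega>)) {..<2}"
    by (rule indep_vars_compose2) (auto simp: h_def)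
  have "(\<integral>\<^sup>+\<omega>. f (X s \<omega> - X 0 \<omega>) * g (X (s + t) \<omega> - X s \<omega>) \<partial>M)
      = (\<integral>\<^sup>+\<omega>. f (X s \<omega> - X 0 \<omega>) \<partial>M) * (\<integral>\<^sup>+\<omega>. g (X (s + t) \<omega> - X s \<omega>) \<partial>M)"
    using indep_vars_nn_integral[OF _ ind]
    by (simp add: numeral_2_eq_2 h_def \<tau>_def mult.commute)
  moreover have "(\<integral>\<^sup>+\<omega>. f (X s \<omega> - X 0 \<omega>) * g (X (s + t) \<omega> - X s \<omega>) \<partial>M) = (\<integral>\<^sup>+\<omega>. f (X s \<omega>) * g (X (s + t) \<omega> - X s \<omega>) \<partial>M)"
    using X0 by (intro nn_integral_cong_AE) auto
  moreover have "(\<integral>\<^sup>+\<omega>. f (X s \<omega> - X 0 \<omega>) \<partial>M) = (\<integral>\<^sup>+\<omega>. f (X s \<omega>) \<partial>M)"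
    using X0 by (intro nn_integral_cong_AE) auto
  moreover have "(\<integral>\<^sup>+\<omega>. g (X (s + t) \<omega> - X s \<omega>) \<partial>M) = (\<integral>\<^sup>+\<omega>. g (X t \<omega>) \<partial>M)"
  proof -
    have "distr M borel (\<lambda>\<omega>. X (s + t) \<omega> - X s \<omega>) = distr M borel (X t)"
      using X st by (simp add: levy_process_def)
    then have "(\<integral>\<^sup>+x. g x \<partial>distr M borel (\<lambda>\<omega>. X (s + t) \<omega> - X s \<omega>)) = (\<integral>\<^sup>+x. g x \<partial>distr M borel (X t))"
      by simp
    then show ?thesis by (simp add: nn_integral_distr)
  qed
  ultimately show ?thesis by simp
qed

lemma (in prob_space) levy_nn_integral_exp:
  assumes X: "levy_process M X"
  shows "(\<integral>\<^sup>+\<omega>. ennreal (exp (\<theta> * X (real n) \<omega>)) \<partial>M) = (\<integral>\<^sup>+\<omega>. ennreal (exp (\<theta> * X 1 \<omega>)) \<partial>M) ^ n"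
proof (induction n)
  case 0
  have "(\<integral>\<^sup>+\<omega>. ennreal (exp (\<theta> * X 0 \<omega>)) \<partial>M) = (\<integral>\<^sup>+\<omega>. 1 \<partial>M)"
    using X by (intro nn_integral_cong_AE) (auto simp: levy_process_def)
  then show ?case by (simp add: emeasure_space_1)
next
  case (Suc n)
  have "(\<integral>\<^sup>+\<omega>. ennreal (exp (\<theta> * X (real n) \<omega>)) * ennreal (exp (\<theta> * (X (real n + 1) \<omega> - X (real n) \<omega>))) \<partial>M)
      = (\<integral>\<^sup>+\<omega>. ennreal (exp (\<theta> * X (real n) \<omega>)) \<partial>M) * (\<integral>\<^sup>+\<omega>. ennreal (exp (\<theta> * X 1 \<omega>)) \<partial>M)"
    by (rule nn_integral_increments[OF X]) auto
  moreover have "ennreal (exp (\<theta> * X (real n) \<omega>)) * ennreal (exp (\<theta> * (X (real n + 1) \<omega> - X (real n) \<omega>)))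
      = ennreal (exp (\<theta> * X (real (Suc n)) \<omega>))" for \<omega>
    by (simp flip: ennreal_mult exp_add add: algebra_simps)
  ultimately show ?case using Suc by (simp add: mult.commute)
qed

text \<open>
  The increments over two adjacent intervals are independent and add up to the increment over their
  union.  The sets are half-lines pointing up for the lower tail bound of \<open>S\<close> and pointing down for
  the one of \<open>H\<close>.
\<close>

lemma (in prob_space) levy_prob_supermultiplicative:
  assumes X: "levy_process M X" and st: "0 \<le> s" "0 \<le> t"
    and [measurable]: "A \<in> sets borel" "B \<in> sets borel" "C \<in> sets borel"
    and sum: "\<And>a b. a \<in> A \<Longrightarrow> b \<in> B \<Longrightarrow> a + b \<in> C"
  shows "prob {\<omega> \<in> space M. X s \<omega> \<in> A} * prob {\<omega> \<in> space M. X t \<omega> \<in> B}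
    \<le> prob {\<omega> \<in> space M. X (s + t) \<omega> \<in> C}"
proof -
  have [measurable]: "X s \<in> borel_measurable M" "X t \<in> borel_measurable M" "X (s + t) \<in> borel_measurable M"
    using X st by (auto simp: levy_process_def)
  have eq: "(\<integral>\<^sup>+\<omega>. indicator D (Y \<omega>) \<partial>M) = ennreal (prob {\<omega> \<in> space M. Y \<omega> \<in> D})"
    if [measurable]: "Y \<in> borel_measurable M" "D \<in> sets borel" for Y and D :: "real set"
  proof -
    have "(\<integral>\<^sup>+\<omega>. indicator D (Y \<omega>) \<partial>M) = (\<integral>\<^sup>+\<omega>. indicator {\<omega> \<in> space M. Y \<omega> \<in> D} \<omega> \<partial>M)"
      by (intro nn_integral_cong) (auto simp: indicator_def)
    then show ?thesis by (simp add: emeasure_eq_measure)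
  qed
  have "(\<integral>\<^sup>+\<omega>. indicator A (X s \<omega>) \<partial>M) * (\<integral>\<^sup>+\<omega>. indicator B (X t \<omega>) \<partial>M)
      = (\<integral>\<^sup>+\<omega>. indicator A (X s \<omega>) * indicator B (X (s + t) \<omega> - X s \<omega>) \<partial>M)"
    by (subst nn_integral_increments[OF X st]) auto
  also have "\<dots> \<le> (\<integral>\<^sup>+\<omega>. indicator C (X (s + t) \<omega>) \<partial>M)"
  proof (rule nn_integral_mono)
    fix \<omega>
    show "indicator A (X s \<omega>) * indicator B (X (s + t) \<omega> - X s \<omega>) \<le> (indicator C (X (s + t) \<omega>) :: ennreal)"
      using sum[of "X s \<omega>" "X (s + t) \<omega> - X s \<omega>"] by (auto simp: indicator_def)
  qed
  finally have "ennreal (prob {\<omega> \<in> space M. X s \<omega> \<in> A} * prob {\<omega> \<in> space M. X t \<omega> \<in> B})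
      \<le> ennreal (prob {\<omega> \<in> space M. X (s + t) \<omega> \<in> C})"
    by (simp add: eq ennreal_mult)
  then show ?thesis by simp
qed

lemma path_component_measurable:
  "0 \<le> t \<Longrightarrow> (\<lambda>p. p t) \<in> borel_measurable path_space"
  unfolding path_space_def by (rule measurable_component_singleton) simp

lemma sample_path_apply: "0 \<le> t \<Longrightarrow> sample_path X \<omega> t = X t \<omega>"
  by (simp add: sample_path_def)

lemma sample_path_measurable:
  assumes "\<And>t. 0 \<le> t \<Longrightarrow> X t \<in> borel_measurable M"
  shows "sample_path X \<in> measurable M path_space"
  unfolding sample_path_def[abs_def] path_space_def using assms by (intro measurable_restrict) auto

lemma nn_integral_process_law:
  assumes "\<And>t. 0 \<le> t \<Longrightarrow> X t \<in> borel_measurable M" "0 \<le> t" "g \<in> borel_measurable borel"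
  shows "(\<integral>\<^sup>+p. g (p t) \<partial>process_law M X) = (\<integral>\<^sup>+\<omega>. g (X t \<omega>) \<partial>M)"
proof -
  have "(\<lambda>p. g (p t)) \<in> borel_measurable path_space"
    using measurable_compose[OF path_component_measurable[OF assms(2)] assms(3)] by simp
  then show ?thesis
    unfolding process_law_def using sample_path_measurable[OF assms(1)] assms(2)
    by (subst nn_integral_distr) (auto simp: sample_path_apply)
qed

lemma (in prob_space) nn_integral_paths_indep:
  fixes f1 f2 g1 g2 :: "real \<Rightarrow> ennreal"
  assumes S: "indep_var path_space (sample_path S1) path_space (sample_path S2)"
    and L: "indep_var path_space (sample_path L1) path_space (sample_path L2)"
    and LS: "indep_var
           (path_space \<Otimes>\<^sub>M path_space) (\<lambda>\<omega>. (sample_path L1 \<omega>, sample_path L2 \<omega>))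
           (path_space \<Otimes>\<^sub>M path_space) (\<lambda>\<omega>. (sample_path S1 \<omega>, sample_path S2 \<omega>))"
    and t: "0 \<le> t" "0 \<le> r" "0 \<le> s"
    and meas: "f1 \<in> borel_measurable borel" "f2 \<in> borel_measurable borel"
      "g1 \<in> borel_measurable borel" "g2 \<in> borel_measurable borel"
  shows "(\<integral>\<^sup>+\<omega>. f1 (L1 t \<omega>) * f2 (L2 t \<omega>) * (g1 (S1 r \<omega>) * g2 (S2 s \<omega>)) \<partial>M) =
    (\<integral>\<^sup>+\<omega>. f1 (L1 t \<omega>) \<partial>M) * (\<integral>\<^sup>+\<omega>. f2 (L2 t \<omega>) \<partial>M) *
    ((\<integral>\<^sup>+\<omega>. g1 (S1 r \<omega>) \<partial>M) * (\<integral>\<^sup>+\<omega>. g2 (S2 s \<omega>) \<partial>M))"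
proof -
  have comp: "(\<lambda>p. h (p u)) \<in> borel_measurable path_space"
    if "0 \<le> u" "h \<in> borel_measurable borel" for u and h :: "real \<Rightarrow> ennreal"
    using measurable_compose[OF path_component_measurable[OF that(1)] that(2)] by simp
  note [measurable] = comp[OF t(1) meas(1)] comp[OF t(1) meas(2)] comp[OF t(2) meas(3)] comp[OF t(3) meas(4)]
  have "(\<integral>\<^sup>+\<omega>. f1 (L1 t \<omega>) * f2 (L2 t \<omega>) * (g1 (S1 r \<omega>) * g2 (S2 s \<omega>)) \<partial>M) =
    (\<integral>\<^sup>+\<omega>. f1 (L1 t \<omega>) * f2 (L2 t \<omega>) \<partial>M) * (\<integral>\<^sup>+\<omega>. g1 (S1 r \<omega>) * g2 (S2 s \<omega>) \<partial>M)"
    using nn_integral_mult_indep[OF LS, of "\<lambda>(p, q). f1 (p t) * f2 (q t)" "\<lambda>(p, q). g1 (p r) * g2 (q s)"] t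
    by (simp add: sample_path_apply)
  moreover have "(\<integral>\<^sup>+\<omega>. f1 (L1 t \<omega>) * f2 (L2 t \<omega>) \<partial>M) = (\<integral>\<^sup>+\<omega>. f1 (L1 t \<omega>) \<partial>M) * (\<integral>\<^sup>+\<omega>. f2 (L2 t \<omega>) \<partial>M)"
    using nn_integral_mult_indep[OF L comp comp, OF t(1) meas(1) t(1) meas(2)] t by (simp add: sample_path_apply)
  moreover have "(\<integral>\<^sup>+\<omega>. g1 (S1 r \<omega>) * g2 (S2 s \<omega>) \<partial>M) = (\<integral>\<^sup>+\<omega>. g1 (S1 r \<omega>) \<partial>M) * (\<integral>\<^sup>+\<omega>. g2 (S2 s \<omega>) \<partial>M)"
    using nn_integral_mult_indep[OF S comp comp, OF t(2) meas(3) t(3) meas(4)] t by (simp add: sample_path_apply)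
  ultimately show ?thesis by simp
qed

text \<open>
  With \<open>b = - a\<close> this transfers a finite moment generating function of \<open>X - Y\<close> to \<open>X\<close>, as the other
  factor is never zero.
\<close>

lemma (in prob_space) exponential_moment_of_difference:
  fixes X Y :: "'a \<Rightarrow> real"
  assumes [measurable]: "Y \<in> borel_measurable M"
    and indep: "(\<integral>\<^sup>+\<omega>. ennreal (exp (a * X \<omega>)) * ennreal (exp (b * Y \<omega>)) \<partial>M)
      = (\<integral>\<^sup>+\<omega>. ennreal (exp (a * X \<omega>)) \<partial>M) * (\<integral>\<^sup>+\<omega>. ennreal (exp (b * Y \<omega>)) \<partial>M)"
    and finite: "(\<integral>\<^sup>+\<omega>. ennreal (exp (a * X \<omega> + b * Y \<omega>)) \<partial>M) < \<infinity>"
  shows "(\<integral>\<^sup>+\<omega>. ennreal (exp (a * X \<omega>)) \<partial>M) < \<infinity>"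
proof -
  have "(\<integral>\<^sup>+\<omega>. ennreal (exp (b * Y \<omega>)) \<partial>M) \<noteq> 0"
  proof
    assume "(\<integral>\<^sup>+\<omega>. ennreal (exp (b * Y \<omega>)) \<partial>M) = 0"
    then have "AE \<omega> in M. False" by (subst (asm) nn_integral_0_iff_AE) auto
    then show False by simp
  qed
  moreover have "(\<integral>\<^sup>+\<omega>. ennreal (exp (a * X \<omega>)) \<partial>M) * (\<integral>\<^sup>+\<omega>. ennreal (exp (b * Y \<omega>)) \<partial>M) < \<infinity>"
    using finite unfolding indep[symmetric] by (simp add: exp_add ennreal_mult)
  ultimately show ?thesis by (metis ennreal_mult_eq_top_iff infinity_ennreal_def less_top)
qed

section \<open>A subordinator at an inverse stable time\<close>

text \<open>
  One of the two summands.  The independence of \<open>L\<close> and \<open>S\<close> is kept out of the locale; it is stated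
  for individual events by the predicate \<open>decoupled\<close> below, because one summand has to be controlled
  also on events that are determined by the other one.
\<close>

locale time_changed_subordinator = prob_space M for M :: "'a measure" +
  fixes S H L :: "real \<Rightarrow> 'a \<Rightarrow> real" and \<nu> :: real
  assumes \<nu>_pos: "0 < \<nu>" and \<nu>_less_1: "\<nu> < 1"
    and S: "subordinator M S" and S_non_null: "\<not> null_process M S"
    and H: "stable_subordinator M \<nu> H"
    and L: "AE \<omega> in M. \<forall>t\<ge>0. L t \<omega> = Inf {u. 0 \<le> u \<and> H u \<omega> > t}"
    and L_measurable: "\<And>t. 0 \<le> t \<Longrightarrow> L t \<in> borel_measurable M"
    and exponential_moment: "\<exists>\<theta>>0. (\<integral>\<^sup>+\<omega>. ennreal (exp (\<theta> * S 1 \<omega>)) \<partial>M) < \<infinity>"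
begin

lemma S_measurable: "0 \<le> t \<Longrightarrow> S t \<in> borel_measurable M"
  using S by (auto simp: subordinator_def levy_process_def)

lemma H_measurable: "0 \<le> t \<Longrightarrow> H t \<in> borel_measurable M"
  using H by (auto simp: stable_subordinator_def subordinator_def levy_process_def)

lemma S_paths:
  "AE \<omega> in M. S 0 \<omega> = 0 \<and> mono_on {0..} (\<lambda>t. S t \<omega>) \<and> (\<forall>t\<ge>0. ((\<lambda>t. S t \<omega>) \<longlongrightarrow> S t \<omega>) (at_right t))"
  using S by (auto simp: subordinator_def levy_process_def cadlag_def elim: eventually_elim2)

lemma H_paths: "AE \<omega> in M. H 0 \<omega> = 0 \<and> mono_on {0..} (\<lambda>t. H t \<omega>)"
  using H by (auto simp: stable_subordinator_def subordinator_def levy_process_def)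

lemma S_nonneg: "0 \<le> t \<Longrightarrow> AE \<omega> in M. 0 \<le> S t \<omega>"
  using S_paths by eventually_elim (metis atLeast_iff mono_onD order_refl)

lemma H_nonneg: "0 \<le> t \<Longrightarrow> AE \<omega> in M. 0 \<le> H t \<omega>"
  using H_paths by eventually_elim (metis atLeast_iff mono_onD order_refl)

definition mgf :: "real \<Rightarrow> ennreal" where
  "mgf \<theta> = (\<integral>\<^sup>+\<omega>. ennreal (exp (\<theta> * S 1 \<omega>)) \<partial>M)"

lemma nn_integral_exp_S: "(\<integral>\<^sup>+\<omega>. ennreal (exp (\<theta> * S (real n) \<omega>)) \<partial>M) = mgf \<theta> ^ n"
  unfolding mgf_def using S by (intro levy_nn_integral_exp) (simp add: subordinator_def)

lemma nn_integral_exp_H: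
  assumes "0 \<le> \<xi>"
  shows "(\<integral>\<^sup>+\<omega>. ennreal (exp (- \<xi> * H (real n) \<omega>)) \<partial>M) = ennreal (exp (- real n * \<xi> powr \<nu>))"
proof -
  have eq: "(\<integral>\<omega>. exp (- \<xi> * H (real n) \<omega>) \<partial>M) = exp (- real n * \<xi> powr \<nu>)"
    using H assms by (auto simp: stable_subordinator_def)
  then have "integrable M (\<lambda>\<omega>. exp (- \<xi> * H (real n) \<omega>))"
    by (metis exp_not_eq_zero not_integrable_integral_eq)
  from nn_integral_eq_integral[OF this] show ?thesis by (simp only: eq) simp
qed

lemma prob_H_le:
  assumes "0 \<le> \<xi>"
  shows "prob {\<omega> \<in> space M. H (real n) \<omega> \<le> y} \<le> exp (\<xi> * y - real n * \<xi> powr \<nu>)"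
proof -
  note [measurable] = H_measurable[of "real n", simplified]
  have "ennreal (prob {\<omega> \<in> space M. H (real n) \<omega> \<le> y}) = (\<integral>\<^sup>+\<omega>. indicator {\<omega> \<in> space M. H (real n) \<omega> \<le> y} \<omega> \<partial>M)"
    by (simp add: emeasure_eq_measure)
  also have "\<dots> \<le> (\<integral>\<^sup>+\<omega>. ennreal (exp (\<xi> * y)) * ennreal (exp (- \<xi> * H (real n) \<omega>)) \<partial>M)"
  proof (rule nn_integral_mono)
    fix \<omega>
    show "indicator {\<omega> \<in> space M. H (real n) \<omega> \<le> y} \<omega> \<le> ennreal (exp (\<xi> * y)) * ennreal (exp (- \<xi> * H (real n) \<omega>))"
      using assms by (auto simp: indicator_def mult_left_mono simp flip: ennreal_mult exp_add ennreal_1)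
  qed
  also have "\<dots> = ennreal (exp (\<xi> * y)) * ennreal (exp (- real n * \<xi> powr \<nu>))"
    using nn_integral_exp_H[OF assms] by (subst nn_integral_cmult) auto
  also have "\<dots> = ennreal (exp (\<xi> * y - real n * \<xi> powr \<nu>))"
    by (simp flip: ennreal_mult exp_add)
  finally show ?thesis by simp
qed

text \<open>
  The passage between \<open>L\<close> and \<open>H\<close> at integer levels.  Everything hinges on \<open>H\<close> being almost surely
  unbounded, so that the infimum defining \<open>L\<close> is over a nonempty set; this holds since
  \<open>P (H n \<le> t) \<le> exp (t - n)\<close> for all \<open>n\<close>.
\<close>

lemma L_paths:
  assumes "0 \<le> t"
  shows "AE \<omega> in M. 0 \<le> L t \<omega> \<and>
    (\<forall>n. (H (real n) \<omega> \<le> t \<longrightarrow> real n \<le> L t \<omega>) \<and> (real n < L t \<omega> \<longrightarrow> H (real n) \<omega> \<le> t))"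
proof -
  note [measurable] = H_measurable[of "real n" for n, simplified]
  have "prob {\<omega> \<in> space M. \<forall>n. H (real n) \<omega> \<le> t} \<le> 0"
  proof (rule LIMSEQ_le_const)
    have "(\<lambda>n. exp (t - real n)) \<longlonglongrightarrow> 0" by real_asymp
    then show "(\<lambda>n. exp (1 * t - real n * 1 powr \<nu>)) \<longlonglongrightarrow> 0" by simp
    show "\<exists>N. \<forall>n\<ge>N. prob {\<omega> \<in> space M. \<forall>n. H (real n) \<omega> \<le> t} \<le> exp (1 * t - real n * 1 powr \<nu>)"
    proof (intro exI allI impI)
      fix n
      have "prob {\<omega> \<in> space M. \<forall>n. H (real n) \<omega> \<le> t} \<le> prob {\<omega> \<in> space M. H (real n) \<omega> \<le> t}"
        by (intro finite_measure_mono) auto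
      also have "\<dots> \<le> exp (1 * t - real n * 1 powr \<nu>)" by (rule prob_H_le) simp
      finally show "prob {\<omega> \<in> space M. \<forall>n. H (real n) \<omega> \<le> t} \<le> \<dots>" .
    qed
  qed
  then have "prob {\<omega> \<in> space M. \<forall>n. H (real n) \<omega> \<le> t} = 0" by (simp add: measure_le_0_iff)
  then have "AE \<omega> in M. \<not> (\<forall>n. H (real n) \<omega> \<le> t)"
    by (subst (asm) prob_eq_0) (auto elim: eventually_mono)
  with L H_paths show ?thesis
  proof eventually_elim
    case (elim \<omega>)
    let ?U = "{u. 0 \<le> u \<and> H u \<omega> > t}"
    have Lt: "L t \<omega> = Inf ?U" using elim(1) assms by blast
    obtain n where "t < H (real n) \<omega>" using elim(3) not_le by blast
    then have ne: "real n \<in> ?U" by simp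
    have bdd: "bdd_below ?U" by (rule bdd_belowI[of _ 0]) simp
    have "0 \<le> L t \<omega>" unfolding Lt using ne by (intro cInf_greatest) blast+
    moreover have "real m \<le> L t \<omega>" if "H (real m) \<omega> \<le> t" for m
      unfolding Lt
    proof (rule cInf_greatest)
      fix u assume "u \<in> ?U"
      then have u: "0 \<le> u" "H (real m) \<omega> < H u \<omega>" using that by auto
      show "real m \<le> u"
      proof (rule ccontr)
        assume "\<not> real m \<le> u"
        then have "H u \<omega> \<le> H (real m) \<omega>" using elim(2) u mono_onD[of "{0..}" "\<lambda>t. H t \<omega>" u "real m"] by auto
        with u show False by simp
      qed
    qed (use ne in blast)
    moreover have "H (real m) \<omega> \<le> t" if "real m < L t \<omega>" for m
    proof (rule ccontr)
      assume "\<not> ?thesis"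
      then have "Inf ?U \<le> real m" using bdd by (intro cInf_lower) auto
      with that Lt show False by simp
    qed
    ultimately show ?case by blast
  qed
qed

text \<open>
  A measurable version of \<open>S (L t)\<close>.  The time \<open>L t\<close> is approximated from the right by grid points of
  mesh \<open>1 / (k + 1)\<close>, strictly larger than \<open>L t\<close> in order to use the right-continuity of the paths; at
  a grid point only countably many random variables are involved.
\<close>

definition time_change :: "real \<Rightarrow> 'a \<Rightarrow> real" where
  "time_change t \<omega> = lim (\<lambda>k. S (real (nat \<lfloor>real (Suc k) * L t \<omega>\<rfloor> + 1) / real (Suc k)) \<omega>)"

lemma time_change_measurable:
  assumes "0 \<le> t"
  shows "time_change t \<in> borel_measurable M"
proof -
  note [measurable] = L_measurable[OF assms]
  have "(\<lambda>\<omega>. S (real (i + 1) / real (Suc k)) \<omega>) \<in> borel_measurable M" for i k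
    by (intro S_measurable) auto
  then have [measurable]: "(\<lambda>\<omega>. S (real (nat \<lfloor>real (Suc k) * L t \<omega>\<rfloor> + 1) / real (Suc k)) \<omega>) \<in> borel_measurable M" for k
    by (rule measurable_compose_countable) measurable
  show ?thesis unfolding time_change_def[abs_def] by measurable
qed

lemma time_change_eq:
  assumes "0 \<le> t"
  shows "AE \<omega> in M. time_change t \<omega> = S (L t \<omega>) \<omega>"
  using S_paths L_paths[OF assms]
proof eventually_elim
  case (elim \<omega>)
  let ?l = "L t \<omega>"
  let ?r = "\<lambda>k. real (nat \<lfloor>real (Suc k) * ?l\<rfloor> + 1) / real (Suc k)"
  have l: "0 \<le> ?l" using elim by blast
  have bounds: "?l < ?r k \<and> ?r k \<le> ?l + 1 / real (Suc k)" for k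
  proof -
    have "0 \<le> real (Suc k) * ?l" using l by simp
    then have "real (Suc k) * ?l < real (nat \<lfloor>real (Suc k) * ?l\<rfloor> + 1)"
      and "real (nat \<lfloor>real (Suc k) * ?l\<rfloor> + 1) \<le> real (Suc k) * ?l + 1"
      by linarith+
    then show ?thesis by (simp add: less_divide_eq divide_le_eq algebra_simps del: of_nat_Suc)
  qed
  have "?r \<longlonglongrightarrow> ?l"
  proof (rule tendsto_sandwich)
    show "(\<lambda>k. ?l) \<longlonglongrightarrow> ?l" by simp
    have "(\<lambda>k. ?l + 1 / real (Suc k)) \<longlonglongrightarrow> ?l + 0"
      by (intro tendsto_add tendsto_const LIMSEQ_Suc lim_1_over_n)
    then show "(\<lambda>k. ?l + 1 / real (Suc k)) \<longlonglongrightarrow> ?l" by simp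
  qed (use bounds in \<open>auto simp: less_imp_le\<close>)
  then have "filterlim ?r (at_right ?l) sequentially"
    unfolding filterlim_at using bounds by (intro conjI always_eventually allI) (auto simp del: of_nat_Suc simp: less_imp_neq[symmetric])
  moreover have "((\<lambda>t. S t \<omega>) \<longlongrightarrow> S ?l \<omega>) (at_right ?l)" using elim l by blast
  ultimately have "(\<lambda>k. S (?r k) \<omega>) \<longlonglongrightarrow> S ?l \<omega>" by (rule filterlim_compose[rotated])
  then show ?case unfolding time_change_def by (rule limI)
qed

lemma time_change_nonneg:
  assumes "0 \<le> t"
  shows "AE \<omega> in M. 0 \<le> time_change t \<omega>"
  using time_change_eq[OF assms] S_paths L_paths[OF assms]
proof eventually_elim
  case (elim \<omega>)
  then have "S 0 \<omega> \<le> S (L t \<omega>) \<omega>" using mono_onD[of "{0..}" "\<lambda>t. S t \<omega>" 0 "L t \<omega>"] by auto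
  then show ?case using elim by simp
qed

lemma time_change_ge:
  assumes "0 \<le> t"
  shows "AE \<omega> in M. real n \<le> L t \<omega> \<longrightarrow> S (real n) \<omega> \<le> time_change t \<omega>"
  using time_change_eq[OF assms] S_paths
proof eventually_elim
  case (elim \<omega>)
  then show ?case using mono_onD[of "{0..}" "\<lambda>t. S t \<omega>" "real n" "L t \<omega>"] by auto
qed

lemma exp_time_change_le:
  assumes "0 \<le> t" "0 \<le> \<theta>"
  shows "AE \<omega> in M. ennreal (exp (\<theta> * time_change t \<omega>))
    \<le> (\<Sum>j. indicator {real j..} (L t \<omega>) * ennreal (exp (\<theta> * S (real (Suc j)) \<omega>)))"
  using time_change_eq[OF \<open>0 \<le> t\<close>] S_paths L_paths[OF \<open>0 \<le> t\<close>]
proof eventually_elim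
  case (elim \<omega>)
  define j where "j = nat \<lfloor>L t \<omega>\<rfloor>"
  define T :: "nat \<Rightarrow> ennreal"
    where "T i = indicator {real i..} (L t \<omega>) * ennreal (exp (\<theta> * S (real (Suc i)) \<omega>))" for i
  have j: "real j \<le> L t \<omega>" "L t \<omega> \<le> real (Suc j)" using elim unfolding j_def by linarith+
  then have "S (L t \<omega>) \<omega> \<le> S (real (Suc j)) \<omega>"
    using elim mono_onD[of "{0..}" "\<lambda>t. S t \<omega>" "L t \<omega>" "real (Suc j)"] by auto
  then have "ennreal (exp (\<theta> * time_change t \<omega>)) \<le> T j"
    using elim j assms by (auto simp: T_def intro!: ennreal_leI mult_left_mono)
  also have "\<dots> = (\<Sum>i\<in>{j}. T i)" by simp
  also have "\<dots> \<le> (\<Sum>i. T i)" by (intro sum_le_suminf) auto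
  finally show ?case unfolding T_def .
qed

lemma prob_L_ge_le:
  assumes "0 \<le> t" "0 \<le> \<xi>"
  shows "prob {\<omega> \<in> space M. real j \<le> L t \<omega>} \<le> exp (\<xi> * t + \<xi> powr \<nu> - real j * \<xi> powr \<nu>)"
proof (cases j)
  case 0
  have "prob {\<omega> \<in> space M. real j \<le> L t \<omega>} \<le> 1" by simp
  also have "1 \<le> exp (\<xi> * t + \<xi> powr \<nu> - real j * \<xi> powr \<nu>)" using 0 assms by simp
  finally show ?thesis .
next
  case (Suc i)
  note [measurable] = L_measurable[OF assms(1)] H_measurable[of "real n" for n, simplified]
  have "prob {\<omega> \<in> space M. real j \<le> L t \<omega>} \<le> prob {\<omega> \<in> space M. H (real i) \<omega> \<le> t}"
  proof (rule finite_measure_mono_AE)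
    show "AE \<omega> in M. \<omega> \<in> {\<omega> \<in> space M. real j \<le> L t \<omega>} \<longrightarrow> \<omega> \<in> {\<omega> \<in> space M. H (real i) \<omega> \<le> t}"
      using L_paths[OF assms(1)]
    proof eventually_elim
      case (elim \<omega>)
      then have "real i < L t \<omega> \<Longrightarrow> H (real i) \<omega> \<le> t" by blast
      then show ?case using Suc by auto
    qed
  qed measurable
  also have "\<dots> \<le> exp (\<xi> * t - real i * \<xi> powr \<nu>)" by (rule prob_H_le[OF assms(2)])
  also have "\<xi> * t - real i * \<xi> powr \<nu> = \<xi> * t + \<xi> powr \<nu> - real j * \<xi> powr \<nu>"
    using Suc by (simp add: algebra_simps)
  finally show ?thesis .
qed

lemma prob_L_ge_ge:
  assumes "0 \<le> t"
  shows "prob {\<omega> \<in> space M. H (real n) \<omega> \<le> t} \<le> prob {\<omega> \<in> space M. real n \<le> L t \<omega>}"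
proof (rule finite_measure_mono_AE)
  note [measurable] = L_measurable[OF assms]
  show "{\<omega> \<in> space M. real n \<le> L t \<omega>} \<in> events" by measurable
  show "AE \<omega> in M. \<omega> \<in> {\<omega> \<in> space M. H (real n) \<omega> \<le> t} \<longrightarrow> \<omega> \<in> {\<omega> \<in> space M. real n \<le> L t \<omega>}"
    using L_paths[OF assms] by eventually_elim auto
qed

section \<open>Exponential upper bounds for the time change\<close>

text \<open>
  The inequality \<open>\<kappa>\<^sub>S \<theta> \<le> \<xi>\<^sup>\<nu>\<close>, with \<open>\<kappa>\<^sub>S\<close> the cumulant function of \<open>S 1\<close>, stated for moment
  generating functions so that neither logarithms nor infinite powers occur.
\<close>

definition admissible :: "real \<Rightarrow> real \<Rightarrow> bool" where
  "admissible \<theta> \<xi> \<longleftrightarrow> 0 \<le> \<theta> \<and> 0 \<le> \<xi> \<and> mgf \<theta> \<le> ennreal (exp (\<xi> powr \<nu>))"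

text \<open>
  Independence of \<open>E\<close>, \<open>L t\<close> and \<open>S n\<close>, in the form in which the Chernoff bound uses it.  For
  \<open>E = space M\<close> this is the independence of \<open>L t\<close> and \<open>S n\<close>.
\<close>

definition decoupled :: "real \<Rightarrow> 'a set \<Rightarrow> bool" where
  "decoupled t E \<longleftrightarrow> E \<in> events \<and>
     (\<forall>n f g. f \<in> borel_measurable borel \<longrightarrow> g \<in> borel_measurable borel \<longrightarrow>
        (\<integral>\<^sup>+\<omega>. indicator E \<omega> * (f (L t \<omega>) * g (S (real n) \<omega>)) \<partial>M)
          = emeasure M E * ((\<integral>\<^sup>+\<omega>. f (L t \<omega>) \<partial>M) * (\<integral>\<^sup>+\<omega>. g (S (real n) \<omega>) \<partial>M)))"

text \<open>
  Monotonicity of \<open>S\<close> reduces the random time to integer times, see \<open>exp_time_change_le\<close>.  With \<open>\<xi>'\<close>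
  as exponent in the bound on \<open>P (L t \<ge> j)\<close>, the term for \<open>j\<close> is of order
  \<open>exp (\<xi>' t + j (\<xi>\<^sup>\<nu> - \<xi>'\<^sup>\<nu>))\<close>, and the strict inequality \<open>\<xi> < \<xi>'\<close> makes the series converge.  The
  constant \<open>K\<close> is uniform in \<open>t\<close>, in the level and in the event.
\<close>

lemma chernoff:
  assumes adm: "admissible \<theta> \<xi>" and "\<xi> < \<xi>'"
  obtains K where "0 \<le> K" "\<And>t a E. 0 \<le> t \<Longrightarrow> decoupled t E \<Longrightarrow>
    prob (E \<inter> {\<omega> \<in> space M. a \<le> time_change t \<omega>}) \<le> K * exp (\<xi>' * t - \<theta> * a) * prob E"
proof -
  define q where "q = exp (\<xi> powr \<nu> - \<xi>' powr \<nu>)"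
  define K where "K = exp (\<xi>' powr \<nu> + \<xi> powr \<nu>) / (1 - q)"
  have "0 \<le> \<xi>" "0 \<le> \<theta>" using adm by (auto simp: admissible_def)
  then have "\<xi> powr \<nu> < \<xi>' powr \<nu>" using \<open>\<xi> < \<xi>'\<close> \<nu>_pos by (intro powr_less_mono2) auto
  then have q: "0 \<le> q" "q < 1" by (auto simp: q_def)
  then have K: "0 \<le> K" by (simp add: K_def)
  have "prob (E \<inter> {\<omega> \<in> space M. a \<le> time_change t \<omega>}) \<le> K * exp (\<xi>' * t - \<theta> * a) * prob E"
    if t: "0 \<le> t" and E: "decoupled t E" for t a E
  proof -
    note [measurable] = L_measurable[OF t] time_change_measurable[OF t] S_measurable[of "real n" for n, simplified]
    have [measurable]: "E \<in> events" using E by (simp add: decoupled_def)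
    let ?T = "\<lambda>j \<omega>. indicator {real j..} (L t \<omega>) * ennreal (exp (\<theta> * S (real (Suc j)) \<omega>))"
    have [measurable]: "(\<lambda>\<omega>. S (real (Suc j)) \<omega>) \<in> borel_measurable M" for j by (rule S_measurable) simp
    have summand: "(\<integral>\<^sup>+\<omega>. indicator E \<omega> * ?T j \<omega> \<partial>M)
      \<le> emeasure M E * ennreal (exp (\<xi>' * t + \<xi>' powr \<nu> + \<xi> powr \<nu>) * q ^ j)" for j
    proof -
      have "(\<integral>\<^sup>+\<omega>. indicator E \<omega> * ?T j \<omega> \<partial>M)
        = emeasure M E * ((\<integral>\<^sup>+\<omega>. indicator {real j..} (L t \<omega>) \<partial>M) * mgf \<theta> ^ Suc j)"
      proof -
        have "(\<lambda>x. ennreal (exp (\<theta> * x))) \<in> borel_measurable borel" "indicator {real j..} \<in> borel_measurable borel"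
          by measurable
        with E show ?thesis
          unfolding decoupled_def nn_integral_exp_S[symmetric] by blast
      qed
      also have "(\<integral>\<^sup>+\<omega>. indicator {real j..} (L t \<omega>) \<partial>M) = (\<integral>\<^sup>+\<omega>. indicator {\<omega> \<in> space M. real j \<le> L t \<omega>} \<omega> \<partial>M)"
        by (intro nn_integral_cong) (auto simp: indicator_def)
      also have "\<dots> = ennreal (prob {\<omega> \<in> space M. real j \<le> L t \<omega>})"
        by (simp add: emeasure_eq_measure)
      also have "ennreal (prob {\<omega> \<in> space M. real j \<le> L t \<omega>}) * mgf \<theta> ^ Suc j
          \<le> ennreal (exp (\<xi>' * t + \<xi>' powr \<nu> - real j * \<xi>' powr \<nu>)) * ennreal (exp (\<xi> powr \<nu>)) ^ Suc j"
        using adm t \<open>0 \<le> \<xi>\<close> \<open>\<xi> < \<xi>'\<close>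
        by (intro mult_mono power_mono ennreal_leI prob_L_ge_le) (auto simp: admissible_def)
      also have "\<dots> = ennreal (exp (\<xi>' * t + \<xi>' powr \<nu> + \<xi> powr \<nu>) * q ^ j)"
        unfolding q_def exp_of_nat_mult[symmetric] ennreal_power[OF exp_ge_zero]
        by (simp flip: ennreal_mult exp_add exp_of_nat_mult power_Suc add: algebra_simps)
      finally show ?thesis by (simp add: mult_left_mono)
    qed
    have "ennreal (exp (\<theta> * a)) * emeasure M (E \<inter> {\<omega> \<in> space M. a \<le> time_change t \<omega>})
      = (\<integral>\<^sup>+\<omega>. ennreal (exp (\<theta> * a)) * indicator (E \<inter> {\<omega> \<in> space M. a \<le> time_change t \<omega>}) \<omega> \<partial>M)"
      by (simp add: nn_integral_cmult_indicator)
    also have "\<dots> \<le> (\<integral>\<^sup>+\<omega>. (\<Sum>j. indicator E \<omega> * ?T j \<omega>) \<partial>M)"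
    proof (rule nn_integral_mono_AE)
      show "AE \<omega> in M. ennreal (exp (\<theta> * a)) * indicator (E \<inter> {\<omega> \<in> space M. a \<le> time_change t \<omega>}) \<omega> \<le> (\<Sum>j. indicator E \<omega> * ?T j \<omega>)"
        using exp_time_change_le[OF t \<open>0 \<le> \<theta>\<close>]
      proof eventually_elim
        case (elim \<omega>)
        have "ennreal (exp (\<theta> * a)) * indicator (E \<inter> {\<omega> \<in> space M. a \<le> time_change t \<omega>}) \<omega>
          \<le> indicator E \<omega> * ennreal (exp (\<theta> * time_change t \<omega>))"
          using \<open>0 \<le> \<theta>\<close> by (auto simp: indicator_def mult_left_mono intro!: ennreal_leI)
        also have "\<dots> \<le> indicator E \<omega> * (\<Sum>j. ?T j \<omega>)" using elim by (intro mult_left_mono) auto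
        finally show ?case by simp
      qed
    qed
    also have "\<dots> = (\<Sum>j. \<integral>\<^sup>+\<omega>. indicator E \<omega> * ?T j \<omega> \<partial>M)"
      by (rule nn_integral_suminf) measurable
    also have "\<dots> \<le> (\<Sum>j. emeasure M E * ennreal (exp (\<xi>' * t + \<xi>' powr \<nu> + \<xi> powr \<nu>) * q ^ j))"
      using summand by (intro suminf_le) auto
    also have "\<dots> = emeasure M E * ennreal (exp (\<xi>' * t + \<xi>' powr \<nu> + \<xi> powr \<nu>) / (1 - q))"
      unfolding ennreal_suminf_cmult using q by (subst suminf_ennreal_geometric) auto
    also have "exp (\<xi>' * t + \<xi>' powr \<nu> + \<xi> powr \<nu>) / (1 - q) = K * exp (\<xi>' * t)"
      by (simp add: K_def exp_add)
    finally have "ennreal (exp (\<theta> * a) * prob (E \<inter> {\<omega> \<in> space M. a \<le> time_change t \<omega>})) \<le> ennreal (prob E * (K * exp (\<xi>' * t)))"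
      using K by (simp add: emeasure_eq_measure ennreal_mult)
    then have "exp (\<theta> * a) * prob (E \<inter> {\<omega> \<in> space M. a \<le> time_change t \<omega>}) \<le> prob E * (K * exp (\<xi>' * t))"
      using K by (subst (asm) ennreal_le_iff) auto
    then show ?thesis by (simp add: exp_diff field_simps)
  qed
  with K show ?thesis using that by blast
qed

section \<open>Tails of the subordinator and of the stable subordinator\<close>

text \<open>
  For every \<open>n\<close> this bounds the probability of \<open>S (L y) \<ge> x\<close> from below when \<open>L\<close> and \<open>S\<close> are
  independent: \<open>H n \<le> y\<close> entails \<open>L y \<ge> n\<close>, and on \<open>L y \<ge> n\<close> the event \<open>S n \<ge> x\<close> suffices.
\<close>

definition tail_product :: "nat \<Rightarrow> real \<Rightarrow> real \<Rightarrow> real" where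
  "tail_product n x y = prob {\<omega> \<in> space M. x \<le> S (real n) \<omega>} * prob {\<omega> \<in> space M. H (real n) \<omega> \<le> y}"

lemma tail_product_nonneg: "0 \<le> tail_product n x y"
  by (simp add: tail_product_def)

lemma tail_product_le_1: "tail_product n x y \<le> 1"
  by (simp add: tail_product_def mult_le_one)

lemma tail_product_mono:
  assumes "x \<le> x'" "y' \<le> y"
  shows "tail_product n x' y' \<le> tail_product n x y"
proof -
  note [measurable] = S_measurable[of "real n" for n, simplified] H_measurable[of "real n" for n, simplified]
  show ?thesis
    unfolding tail_product_def using assms by (intro mult_mono finite_measure_mono) auto
qed

lemma tail_product_supermultiplicative:
  "tail_product n x y * tail_product m x' y' \<le> tail_product (n + m) (x + x') (y + y')"
proof -
  have S': "levy_process M S" and H': "levy_process M H"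
    using S H by (auto simp: subordinator_def stable_subordinator_def)
  have "prob {\<omega> \<in> space M. x \<le> S (real n) \<omega>} * prob {\<omega> \<in> space M. x' \<le> S (real m) \<omega>}
      \<le> prob {\<omega> \<in> space M. x + x' \<le> S (real (n + m)) \<omega>}"
    using levy_prob_supermultiplicative[OF S', of "real n" "real m" "{x..}" "{x'..}" "{x + x'..}"] by simp
  moreover have "prob {\<omega> \<in> space M. H (real n) \<omega> \<le> y} * prob {\<omega> \<in> space M. H (real m) \<omega> \<le> y'}
      \<le> prob {\<omega> \<in> space M. H (real (n + m)) \<omega> \<le> y + y'}"
    using levy_prob_supermultiplicative[OF H', of "real n" "real m" "{..y}" "{..y'}" "{..y + y'}"] by simp
  ultimately have "(prob {\<omega> \<in> space M. x \<le> S (real n) \<omega>} * prob {\<omega> \<in> space M. x' \<le> S (real m) \<omega>})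
      * (prob {\<omega> \<in> space M. H (real n) \<omega> \<le> y} * prob {\<omega> \<in> space M. H (real m) \<omega> \<le> y'})
      \<le> tail_product (n + m) (x + x') (y + y')"
    unfolding tail_product_def by (intro mult_mono) auto
  then show ?thesis by (simp add: tail_product_def mult_ac)
qed

lemma tail_product_0:
  assumes "0 \<le> y"
  shows "tail_product 0 0 y = 1"
proof -
  note [measurable] = S_measurable[of 0, simplified] H_measurable[of 0, simplified]
  have "prob {\<omega> \<in> space M. 0 \<le> S 0 \<omega>} = 1"
    using S_paths by (subst prob_Collect_eq_1) (auto elim: eventually_mono)
  moreover have "prob {\<omega> \<in> space M. H 0 \<omega> \<le> y} = 1"
    using H_paths assms by (subst prob_Collect_eq_1) (auto elim: eventually_mono)
  ultimately show ?thesis by (simp add: tail_product_def)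
qed

text \<open>
  If \<open>H n > y\<close> held almost surely, the Laplace exponent \<open>n \<xi>\<^sup>\<nu>\<close> would be at least \<open>\<xi> y\<close>, but it grows
  more slowly than linearly as \<open>\<nu> < 1\<close>.
\<close>

lemma prob_H_le_pos:
  assumes "0 < y"
  shows "0 < prob {\<omega> \<in> space M. H (real n) \<omega> \<le> y}"
proof (rule ccontr)
  note [measurable] = H_measurable[of "real n" for n, simplified]
  assume "\<not> ?thesis"
  then have "prob {\<omega> \<in> space M. H (real n) \<omega> \<le> y} = 0" by (simp add: not_less measure_le_0_iff)
  then have ae: "AE \<omega> in M. y < H (real n) \<omega>"
    by (subst (asm) prob_Collect_eq_0) (auto elim: eventually_mono)
  (* chosen such that \<xi> * y = (n + 1) * \<xi> powr \<nu> *)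
  define \<xi> where "\<xi> = ((real n + 1) / y) powr (1 / (1 - \<nu>))"
  have \<xi>: "0 < \<xi>" using assms by (simp add: \<xi>_def add_nonneg_eq_0_iff)
  have "ennreal (exp (- real n * \<xi> powr \<nu>)) = (\<integral>\<^sup>+\<omega>. ennreal (exp (- \<xi> * H (real n) \<omega>)) \<partial>M)"
    using \<xi> by (subst nn_integral_exp_H) auto
  also have "\<dots> \<le> (\<integral>\<^sup>+\<omega>. ennreal (exp (- \<xi> * y)) \<partial>M)"
    using ae \<xi> by (intro nn_integral_mono_AE) (auto intro!: ennreal_leI elim!: eventually_mono)
  also have "\<dots> = ennreal (exp (- \<xi> * y))" by (simp add: emeasure_space_1)
  finally have "\<xi> * y \<le> real n * \<xi> powr \<nu>" by simp
  moreover have "\<xi> * y = (real n + 1) * \<xi> powr \<nu>"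
  proof -
    have "\<xi> = \<xi> powr \<nu> * \<xi> powr (1 - \<nu>)" using \<xi> by (simp flip: powr_add)
    moreover have "\<xi> powr (1 - \<nu>) = (real n + 1) / y"
      using assms \<nu>_less_1 by (simp add: \<xi>_def powr_powr)
    ultimately have "\<xi> * y = \<xi> powr \<nu> * ((real n + 1) / y) * y" by simp
    then show ?thesis using assms by simp
  qed
  ultimately show False using \<xi> by (simp add: algebra_simps)
qed

text \<open>
  A subordinator that is not null exceeds some \<open>\<eta> > 0\<close> at some integer time with positive
  probability.  Supermultiplicativity carries this over to levels as high as desired, and by
  \<open>prob_H_le_pos\<close> the time allotted to \<open>H\<close> can be divided accordingly.
\<close>

lemma tail_product_pos: "\<exists>n. 0 < tail_product n x 1"
proof -
  note [measurable] = S_measurable[of "real n" for n, simplified]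
  have "\<exists>n. \<not> (AE \<omega> in M. S (real n) \<omega> \<le> 0)"
  proof (rule ccontr)
    assume "\<not> ?thesis"
    then have "AE \<omega> in M. \<forall>n. S (real n) \<omega> \<le> 0" by (simp add: AE_all_countable)
    with S_paths have "AE \<omega> in M. \<forall>t\<ge>0. S t \<omega> = 0"
    proof eventually_elim
      case (elim \<omega>)
      show ?case
      proof (intro allI impI antisym)
        fix t :: real assume t: "0 \<le> t"
        obtain n where "t \<le> real n" using real_arch_simple by blast
        then have "S t \<omega> \<le> S (real n) \<omega>" using elim t mono_onD[of "{0..}" "\<lambda>t. S t \<omega>" t "real n"] by auto
        then show "S t \<omega> \<le> 0" using elim by (meson order_trans)
        have "S 0 \<omega> \<le> S t \<omega>" using elim t mono_onD[of "{0..}" "\<lambda>t. S t \<omega>" 0 t] by auto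
        then show "0 \<le> S t \<omega>" using elim by simp
      qed
    qed
    then show False using S_non_null by (simp add: null_process_def)
  qed
  then obtain n where n: "\<not> (AE \<omega> in M. S (real n) \<omega> \<le> 0)" by blast
  have "\<exists>k. \<not> (AE \<omega> in M. S (real n) \<omega> < 1 / real (Suc k))"
  proof (rule ccontr)
    assume "\<not> ?thesis"
    then have "AE \<omega> in M. \<forall>k. S (real n) \<omega> < 1 / real (Suc k)" by (simp add: AE_all_countable)
    then have "AE \<omega> in M. S (real n) \<omega> \<le> 0"
    proof eventually_elim
      case (elim \<omega>)
      then show ?case by (metis nat_approx_posE less_le_not_le less_trans not_le)
    qed
    with n show False by simp
  qed
  then obtain k where k: "\<not> (AE \<omega> in M. S (real n) \<omega> < 1 / real (Suc k))" by blast
  define \<eta> where "\<eta> = 1 / real (Suc k)"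
  have "0 < \<eta>" by (simp add: \<eta>_def)
  have pos: "0 < prob {\<omega> \<in> space M. \<eta> \<le> S (real n) \<omega>}"
  proof (rule ccontr)
    assume "\<not> ?thesis"
    then have "prob {\<omega> \<in> space M. \<eta> \<le> S (real n) \<omega>} = 0" by (simp add: not_less measure_le_0_iff)
    then have "AE \<omega> in M. S (real n) \<omega> < \<eta>"
      by (subst (asm) prob_Collect_eq_0) (auto elim: eventually_mono)
    with k show False by (simp add: \<eta>_def)
  qed
  obtain N :: nat where "x / \<eta> < real N" using reals_Archimedean2 by blast
  then have N: "x \<le> real (Suc N) * \<eta>" using \<open>0 < \<eta>\<close> by (simp add: divide_less_eq algebra_simps)
  have "0 < tail_product n \<eta> (1 / real (Suc N))"
    unfolding tail_product_def using pos prob_H_le_pos by simp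
  then have "0 < tail_product n \<eta> (1 / real (Suc N)) ^ Suc N" by simp
  also have "\<dots> \<le> tail_product (Suc N * n) (real (Suc N) * \<eta>) (real (Suc N) * (1 / real (Suc N)))"
    using tail_product_nonneg tail_product_supermultiplicative \<open>0 < \<eta>\<close>
    by (intro supermultiplicative_power) auto
  also have "\<dots> \<le> tail_product (Suc N * n) x 1"
    using N by (intro tail_product_mono) auto
  finally show ?thesis by blast
qed

lemma tail_product_le:
  assumes "admissible \<theta> \<xi>"
  shows "tail_product n x y \<le> exp (\<xi> * y - \<theta> * x)"
proof -
  note [measurable] = S_measurable[of "real n" for n, simplified]
  have \<theta>: "0 \<le> \<theta>" "0 \<le> \<xi>" using assms by (auto simp: admissible_def)
  have "ennreal (exp (\<theta> * x)) * ennreal (prob {\<omega> \<in> space M. x \<le> S (real n) \<omega>})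
      = (\<integral>\<^sup>+\<omega>. ennreal (exp (\<theta> * x)) * indicator {\<omega> \<in> space M. x \<le> S (real n) \<omega>} \<omega> \<partial>M)"
    by (simp add: nn_integral_cmult_indicator emeasure_eq_measure)
  also have "\<dots> \<le> (\<integral>\<^sup>+\<omega>. ennreal (exp (\<theta> * S (real n) \<omega>)) \<partial>M)"
    using \<theta> by (intro nn_integral_mono) (auto simp: indicator_def mult_left_mono intro!: ennreal_leI)
  also have "\<dots> \<le> ennreal (exp (\<xi> powr \<nu>)) ^ n"
    unfolding nn_integral_exp_S using assms by (intro power_mono) (auto simp: admissible_def)
  also have "\<dots> = ennreal (exp (real n * \<xi> powr \<nu>))"
    by (simp add: ennreal_power exp_of_nat_mult)
  finally have "exp (\<theta> * x) * prob {\<omega> \<in> space M. x \<le> S (real n) \<omega>} \<le> exp (real n * \<xi> powr \<nu>)"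
    by (simp flip: ennreal_mult)
  then have "prob {\<omega> \<in> space M. x \<le> S (real n) \<omega>} \<le> exp (real n * \<xi> powr \<nu> - \<theta> * x)"
    by (simp add: exp_diff field_simps)
  then have "tail_product n x y \<le> exp (real n * \<xi> powr \<nu> - \<theta> * x) * exp (\<xi> * y - real n * \<xi> powr \<nu>)"
    unfolding tail_product_def using \<theta> by (intro mult_mono prob_H_le) auto
  then show ?thesis by (simp flip: exp_add)
qed

text \<open>
  The converse of \<open>tail_product_le\<close>, up to an arbitrarily small loss.  The moment generating function
  of \<open>S n\<close> and the Laplace transform of \<open>H n\<close> are bounded by sums over the tails; the product of the
  two sums is a double geometric series whose value does not depend on \<open>n\<close>.  But the product of the
  transforms is an \<open>n\<close>-th power, so its base cannot exceed \<open>1\<close>.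
\<close>

lemma admissible_if_tail_product_le:
  assumes bound: "\<And>n x y. 0 \<le> x \<Longrightarrow> 0 < y \<Longrightarrow> tail_product n x y \<le> exp (\<xi> * y - \<theta> * x)"
    and "0 \<le> \<theta>'" "\<theta>' < \<theta>" "0 \<le> \<xi>" "\<xi> < \<xi>'"
  shows "admissible \<theta>' \<xi>'"
proof -
  note [measurable] = S_measurable[of "real n" for n, simplified] H_measurable[of "real n" for n, simplified]
  define p where "p = exp (\<theta>' - \<theta>)"
  define q where "q = exp (\<xi> - \<xi>')"
  define C where "C = exp (\<theta>' + \<xi>) / (1 - q) / (1 - p)"
  have p: "0 \<le> p" "p < 1" and q: "0 \<le> q" "q < 1" using assms by (auto simp: p_def q_def)
  have bounded: "mgf \<theta>' ^ n * ennreal (exp (- real n * \<xi>' powr \<nu>)) \<le> ennreal C" for n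
  proof -
    have "mgf \<theta>' ^ n = (\<integral>\<^sup>+\<omega>. ennreal (exp (\<theta>' * S (real n) \<omega>)) \<partial>M)"
      by (simp add: nn_integral_exp_S)
    also have "\<dots> \<le> (\<integral>\<^sup>+\<omega>. (\<Sum>j. ennreal (exp (\<theta>' * real (Suc j))) * indicator {\<omega> \<in> space M. real j \<le> S (real n) \<omega>} \<omega>) \<partial>M)"
    proof (rule nn_integral_mono_AE)
      show "AE \<omega> in M. ennreal (exp (\<theta>' * S (real n) \<omega>))
        \<le> (\<Sum>j. ennreal (exp (\<theta>' * real (Suc j))) * indicator {\<omega> \<in> space M. real j \<le> S (real n) \<omega>} \<omega>)"
        using S_nonneg[of "real n", simplified] AE_space
      proof eventually_elim
        case (elim \<omega>)
        define T :: "nat \<Rightarrow> ennreal" where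
          "T j = ennreal (exp (\<theta>' * real (Suc j))) * indicator {\<omega> \<in> space M. real j \<le> S (real n) \<omega>} \<omega>" for j
        define j where "j = nat \<lfloor>S (real n) \<omega>\<rfloor>"
        have j: "real j \<le> S (real n) \<omega>" "S (real n) \<omega> \<le> real (Suc j)" using elim unfolding j_def by linarith+
        then have "ennreal (exp (\<theta>' * S (real n) \<omega>)) \<le> T j"
          using elim assms by (auto simp: T_def intro!: ennreal_leI mult_left_mono)
        also have "\<dots> = (\<Sum>i\<in>{j}. T i)" by simp
        also have "\<dots> \<le> (\<Sum>i. T i)" by (intro sum_le_suminf) auto
        finally show ?case unfolding T_def .
      qed
    qed
    also have "\<dots> = (\<Sum>j. ennreal (exp (\<theta>' * real (Suc j)) * prob {\<omega> \<in> space M. real j \<le> S (real n) \<omega>}))"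
      by (subst nn_integral_suminf) (auto simp: nn_integral_cmult_indicator emeasure_eq_measure ennreal_mult)
    finally have S_sum: "mgf \<theta>' ^ n \<le> \<dots>" .
    have "ennreal (exp (- real n * \<xi>' powr \<nu>)) = (\<integral>\<^sup>+\<omega>. ennreal (exp (- \<xi>' * H (real n) \<omega>)) \<partial>M)"
      using assms by (subst nn_integral_exp_H) auto
    also have "\<dots> \<le> (\<integral>\<^sup>+\<omega>. (\<Sum>k. ennreal (exp (- \<xi>' * real k)) * indicator {\<omega> \<in> space M. H (real n) \<omega> \<le> real (Suc k)} \<omega>) \<partial>M)"
    proof (rule nn_integral_mono_AE)
      show "AE \<omega> in M. ennreal (exp (- \<xi>' * H (real n) \<omega>))
        \<le> (\<Sum>k. ennreal (exp (- \<xi>' * real k)) * indicator {\<omega> \<in> space M. H (real n) \<omega> \<le> real (Suc k)} \<omega>)"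
        using H_nonneg[of "real n", simplified] AE_space
      proof eventually_elim
        case (elim \<omega>)
        define T :: "nat \<Rightarrow> ennreal" where
          "T k = ennreal (exp (- \<xi>' * real k)) * indicator {\<omega> \<in> space M. H (real n) \<omega> \<le> real (Suc k)} \<omega>" for k
        define k where "k = nat \<lfloor>H (real n) \<omega>\<rfloor>"
        have k: "real k \<le> H (real n) \<omega>" "H (real n) \<omega> \<le> real (Suc k)" using elim unfolding k_def by linarith+
        then have "ennreal (exp (- \<xi>' * H (real n) \<omega>)) \<le> T k"
          using elim assms by (auto simp: T_def intro!: ennreal_leI mult_left_mono)
        also have "\<dots> = (\<Sum>i\<in>{k}. T i)" by simp
        also have "\<dots> \<le> (\<Sum>i. T i)" by (intro sum_le_suminf) auto
        finally show ?case unfolding T_def .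
      qed
    qed
    also have "\<dots> = (\<Sum>k. ennreal (exp (- \<xi>' * real k) * prob {\<omega> \<in> space M. H (real n) \<omega> \<le> real (Suc k)}))"
      by (subst nn_integral_suminf) (auto simp: nn_integral_cmult_indicator emeasure_eq_measure ennreal_mult)
    finally have H_sum: "ennreal (exp (- real n * \<xi>' powr \<nu>)) \<le> \<dots>" .
    have "mgf \<theta>' ^ n * ennreal (exp (- real n * \<xi>' powr \<nu>))
      \<le> (\<Sum>j. ennreal (exp (\<theta>' * real (Suc j)) * prob {\<omega> \<in> space M. real j \<le> S (real n) \<omega>}))
        * (\<Sum>k. ennreal (exp (- \<xi>' * real k) * prob {\<omega> \<in> space M. H (real n) \<omega> \<le> real (Suc k)}))"
      using S_sum H_sum by (intro mult_mono) auto
    also have "\<dots> = (\<Sum>j. \<Sum>k. ennreal (exp (\<theta>' * real (Suc j)) * prob {\<omega> \<in> space M. real j \<le> S (real n) \<omega>})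
        * ennreal (exp (- \<xi>' * real k) * prob {\<omega> \<in> space M. H (real n) \<omega> \<le> real (Suc k)}))"
      unfolding ennreal_suminf_cmult ennreal_suminf_multc ..
    also have "\<dots> \<le> (\<Sum>j. \<Sum>k. ennreal (exp (\<theta>' + \<xi>) * p ^ j * q ^ k))"
    proof (intro suminf_le allI summableI)
      fix j k
      have "exp (\<theta>' * real (Suc j)) * prob {\<omega> \<in> space M. real j \<le> S (real n) \<omega>}
          * (exp (- \<xi>' * real k) * prob {\<omega> \<in> space M. H (real n) \<omega> \<le> real (Suc k)})
        = exp (\<theta>' * real (Suc j) - \<xi>' * real k) * tail_product n (real j) (real (Suc k))"
        by (simp add: tail_product_def exp_diff exp_minus field_simps)
      also have "\<dots> \<le> exp (\<theta>' * real (Suc j) - \<xi>' * real k) * exp (\<xi> * real (Suc k) - \<theta> * real j)"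
        by (intro mult_left_mono bound) auto
      also have "\<dots> = exp (\<theta>' + \<xi>) * p ^ j * q ^ k"
        unfolding p_def q_def by (simp flip: exp_add exp_of_nat_mult add: algebra_simps)
      finally show "ennreal (exp (\<theta>' * real (Suc j)) * prob {\<omega> \<in> space M. real j \<le> S (real n) \<omega>})
          * ennreal (exp (- \<xi>' * real k) * prob {\<omega> \<in> space M. H (real n) \<omega> \<le> real (Suc k)})
        \<le> ennreal (exp (\<theta>' + \<xi>) * p ^ j * q ^ k)"
        by (subst ennreal_mult[symmetric]) (auto intro!: ennreal_leI)
    qed
    also have "\<dots> = (\<Sum>j. ennreal (exp (\<theta>' + \<xi>) / (1 - q) * p ^ j))"
      using p q by (subst suminf_ennreal_geometric) auto
    also have "\<dots> = ennreal C"
      unfolding C_def using p q by (subst suminf_ennreal_geometric) auto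
    finally show ?thesis .
  qed
  have "mgf \<theta>' \<noteq> \<infinity>"
  proof
    assume "mgf \<theta>' = \<infinity>"
    with bounded[of 1] show False by (simp add: ennreal_top_mult top_unique)
  qed
  then obtain m where m: "mgf \<theta>' = ennreal m" "0 \<le> m" by (cases "mgf \<theta>'") auto
  have "m \<le> exp (\<xi>' powr \<nu>)"
  proof (rule ccontr)
    assume less: "\<not> ?thesis"
    (* The powers of r > 1 would be unbounded. *)
    define r where "r = m * exp (- (\<xi>' powr \<nu>))"
    have "1 < r" using less by (simp add: r_def exp_minus field_simps)
    then obtain n where "C < r ^ n" using real_arch_pow by blast
    moreover have "r ^ n \<le> C"
    proof -
      have "r ^ n = m ^ n * exp (- real n * \<xi>' powr \<nu>)"
        by (simp add: r_def power_mult_distrib flip: exp_of_nat_mult)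
      moreover have "0 \<le> C" using p q by (simp add: C_def)
      ultimately show ?thesis using bounded[of n] m by (simp add: ennreal_power flip: ennreal_mult)
    qed
    ultimately show False by simp
  qed
  then show ?thesis using assms m by (auto simp: admissible_def intro!: ennreal_leI)
qed

section \<open>The one-sided rate function\<close>

text \<open>
  The function \<open>\<Psi>\<close> on one half-line; \<open>rate\<close> is its Legendre transform over that half-line.
\<close>

definition cost :: "real \<Rightarrow> ereal" where
  "cost \<theta> = ereal_powr (log_mgf M (S 1) \<theta>) (1 / \<nu>)"

definition rate :: "real \<Rightarrow> ereal" where
  "rate x = (SUP \<theta>\<in>{0..}. ereal (\<theta> * x) - cost \<theta>)"

lemma mgf_ge_1:
  assumes "0 \<le> \<theta>"
  shows "1 \<le> mgf \<theta>"
proof -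
  have "1 = (\<integral>\<^sup>+\<omega>. 1 \<partial>M)" by (simp add: emeasure_space_1)
  also have "\<dots> \<le> mgf \<theta>"
    unfolding mgf_def using S_nonneg[of 1, simplified] assms
    by (intro nn_integral_mono_AE) (auto elim!: eventually_mono simp flip: ennreal_1 intro!: ennreal_leI)
  finally show ?thesis .
qed

lemma mgf_0: "mgf 0 = 1"
  by (simp add: mgf_def emeasure_space_1)

lemma cost_nonneg: "0 \<le> cost \<theta>"
  by (simp add: cost_def ereal_powr_def)

lemma cost_eq_infinity: "mgf \<theta> = \<infinity> \<Longrightarrow> cost \<theta> = \<infinity>"
  by (simp add: cost_def log_mgf_def mgf_def[symmetric] log_ennreal_def ereal_powr_def)

lemma cost_eq_ereal: "mgf \<theta> = ennreal m \<Longrightarrow> 0 < m \<Longrightarrow> cost \<theta> = ereal (ln m powr (1 / \<nu>))"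
  by (simp add: cost_def log_mgf_def mgf_def[symmetric] log_ennreal_ennreal ereal_powr_def)

lemma cost_le_iff:
  assumes "0 \<le> \<theta>" "0 \<le> \<xi>"
  shows "cost \<theta> \<le> ereal \<xi> \<longleftrightarrow> admissible \<theta> \<xi>"
proof (cases "mgf \<theta>")
  case top
  then have "cost \<theta> = \<infinity>" by (simp add: cost_eq_infinity)
  with top show ?thesis by (simp add: admissible_def top_unique)
next
  case (real m)
  then have m: "1 \<le> m" using mgf_ge_1[OF assms(1)] by (simp flip: ennreal_1)
  then have "cost \<theta> = ereal (ln m powr (1 / \<nu>))"
    using real by (simp add: cost_eq_ereal)
  moreover have "ln m powr (1 / \<nu>) \<le> \<xi> \<longleftrightarrow> ln m \<le> \<xi> powr \<nu>"
  proof
    assume "ln m powr (1 / \<nu>) \<le> \<xi>"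
    then have "(ln m powr (1 / \<nu>)) powr \<nu> \<le> \<xi> powr \<nu>" using \<nu>_pos by (intro powr_mono2) auto
    then show "ln m \<le> \<xi> powr \<nu>" using \<nu>_pos m by (simp add: powr_powr)
  next
    assume "ln m \<le> \<xi> powr \<nu>"
    then have "ln m powr (1 / \<nu>) \<le> (\<xi> powr \<nu>) powr (1 / \<nu>)" using \<nu>_pos m by (intro powr_mono2) auto
    then show "ln m powr (1 / \<nu>) \<le> \<xi>" using \<nu>_pos assms by (simp add: powr_powr)
  qed
  moreover have "ln m \<le> \<xi> powr \<nu> \<longleftrightarrow> m \<le> exp (\<xi> powr \<nu>)" using m by (metis exp_le_cancel_iff exp_ln less_le_trans zero_less_one)
  ultimately show ?thesis using assms real by (simp add: admissible_def)
qed

lemma admissible_0: "admissible 0 0"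
  by (simp add: admissible_def mgf_0)

lemma cost_0: "cost 0 = 0"
  using cost_le_iff[of 0 0] admissible_0 cost_nonneg[of 0] by (simp add: antisym zero_ereal_def)

lemma rate_ge:
  assumes "admissible \<theta> \<xi>"
  shows "ereal (\<theta> * x - \<xi>) \<le> rate x"
proof -
  have \<theta>: "0 \<le> \<theta>" "0 \<le> \<xi>" using assms by (auto simp: admissible_def)
  then have "cost \<theta> \<le> ereal \<xi>" using assms cost_le_iff by simp
  then have "ereal (\<theta> * x) - ereal \<xi> \<le> ereal (\<theta> * x) - cost \<theta>" by (intro ereal_minus_mono) auto
  also have "\<dots> \<le> rate x" unfolding rate_def using \<theta> by (intro SUP_upper) auto
  finally show ?thesis by simp
qed

lemma less_rateE:
  assumes "ereal c < rate x"
  obtains \<theta> \<xi> where "admissible \<theta> \<xi>" "c < \<theta> * x - \<xi>"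
proof -
  obtain \<theta> where \<theta>: "0 \<le> \<theta>" "ereal c < ereal (\<theta> * x) - cost \<theta>"
    using assms unfolding rate_def by (auto simp: less_SUP_iff)
  then obtain \<xi> where \<xi>: "cost \<theta> = ereal \<xi>" "0 \<le> \<xi>"
    using cost_nonneg[of \<theta>] by (cases "cost \<theta>") auto
  then have "admissible \<theta> \<xi>" using cost_le_iff[of \<theta> \<xi>] \<theta> by simp
  moreover have "c < \<theta> * x - \<xi>" using \<theta> \<xi> by simp
  ultimately show ?thesis by (rule that)
qed

lemma rate_nonneg: "0 \<le> rate x"
  using rate_ge[OF admissible_0, of x] by (simp add: zero_ereal_def)

lemma rate_0: "rate 0 = 0"
proof (rule antisym[OF _ rate_nonneg], rule ccontr)
  assume "\<not> rate 0 \<le> 0"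
  then have "ereal 0 < rate 0" by (simp add: zero_ereal_def)
  then obtain \<theta> \<xi> where "admissible \<theta> \<xi>" "0 < \<theta> * 0 - \<xi>" by (rule less_rateE)
  then show False by (simp add: admissible_def)
qed

text \<open>
  A single \<open>n\<close> with \<open>S n \<ge> x\<close> and \<open>H n \<le> 1\<close> possible bounds all \<open>\<theta> x - \<xi>\<close> with \<open>(\<theta>, \<xi>)\<close> admissible.
\<close>

lemma rate_finite: "\<exists>r. rate x = ereal r"
proof -
  obtain n where n: "0 < tail_product n x 1" using tail_product_pos by blast
  have "rate x \<le> ereal (- ln (tail_product n x 1))"
  proof (rule ccontr)
    assume "\<not> ?thesis"
    then have "ereal (- ln (tail_product n x 1)) < rate x" by simp
    then obtain \<theta> \<xi> where "admissible \<theta> \<xi>" and less: "- ln (tail_product n x 1) < \<theta> * x - \<xi>"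
      by (rule less_rateE)
    then have "tail_product n x 1 \<le> exp (\<xi> * 1 - \<theta> * x)" by (intro tail_product_le)
    then have "ln (tail_product n x 1) \<le> ln (exp (\<xi> * 1 - \<theta> * x))"
      using n by (subst ln_le_cancel_iff) auto
    then have "ln (tail_product n x 1) \<le> \<xi> - \<theta> * x" by simp
    with less show False by simp
  qed
  then show ?thesis using rate_nonneg[of x] by (cases "rate x") auto
qed

lemma admissible_of_exponential_moment: "\<exists>\<theta> \<xi>. 0 < \<theta> \<and> admissible \<theta> \<xi>"
proof -
  obtain \<theta> where \<theta>: "0 < \<theta>" "mgf \<theta> < \<infinity>" using exponential_moment by (auto simp: mgf_def)
  then obtain m where m: "mgf \<theta> = ennreal m" "0 \<le> m" by (cases "mgf \<theta>") auto
  then have "1 \<le> m" using mgf_ge_1[of \<theta>] \<theta> by (simp flip: ennreal_1)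
  then obtain r where "cost \<theta> = ereal r" using cost_eq_ereal[OF m(1)] by simp
  then show ?thesis using cost_le_iff[of \<theta> r] \<theta> cost_nonneg[of \<theta>] by auto
qed

text \<open>
  By convexity of \<open>exp\<close>, the moment generating function lies below its chord between \<open>0\<close> and a point
  where it is finite.
\<close>

lemma mgf_le_near_0: "\<exists>\<theta>1>0. \<exists>C>0. \<forall>\<theta>. 0 \<le> \<theta> \<and> \<theta> \<le> \<theta>1 \<longrightarrow> mgf \<theta> \<le> ennreal (exp (C * \<theta>))"
proof -
  note [measurable] = S_measurable[of 1, simplified]
  obtain \<theta>1 where \<theta>1: "0 < \<theta>1" "mgf \<theta>1 < \<infinity>" using exponential_moment by (auto simp: mgf_def)
  then obtain m where m: "mgf \<theta>1 = ennreal m" "0 \<le> m" by (cases "mgf \<theta>1") auto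
  have "1 \<le> m" using mgf_ge_1[of \<theta>1] \<theta>1 m by (simp flip: ennreal_1)
  have "mgf \<theta> \<le> ennreal (exp (m / \<theta>1 * \<theta>))" if \<theta>: "0 \<le> \<theta>" "\<theta> \<le> \<theta>1" for \<theta>
  proof -
    define l where "l = \<theta> / \<theta>1"
    have l: "0 \<le> l" "l \<le> 1" "\<theta> = l * \<theta>1" using \<theta> \<theta>1 by (auto simp: l_def)
    have "exp (\<theta> * s) \<le> (1 - l) + l * exp (\<theta>1 * s)" for s :: real
      using convex_onD[OF exp_convex, of l 0 "\<theta>1 * s"] l by (simp add: mult.assoc)
    then have "mgf \<theta> \<le> (\<integral>\<^sup>+\<omega>. ennreal (1 - l) + ennreal l * ennreal (exp (\<theta>1 * S 1 \<omega>)) \<partial>M)"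
      unfolding mgf_def using l by (intro nn_integral_mono) (simp flip: ennreal_mult ennreal_plus)
    also have "\<dots> = ennreal (1 - l) + ennreal l * mgf \<theta>1"
      unfolding mgf_def by (simp add: nn_integral_add nn_integral_cmult emeasure_space_1)
    also have "\<dots> = ennreal (1 - l + l * m)"
      using l m by (simp flip: ennreal_mult ennreal_plus)
    also have "\<dots> \<le> ennreal (exp (m / \<theta>1 * \<theta>))"
    proof (rule ennreal_leI)
      have "1 - l + l * m \<le> 1 + l * m" using l by simp
      also have "\<dots> \<le> exp (l * m)" by (rule exp_ge_add_one_self)
      finally show "1 - l + l * m \<le> exp (m / \<theta>1 * \<theta>)" by (simp add: l_def mult.commute)
    qed
    finally show ?thesis .
  qed
  then show ?thesis using \<theta>1 \<open>1 \<le> m\<close> by (intro exI[of _ \<theta>1] conjI exI[of _ "m / \<theta>1"]) auto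
qed

text \<open>
  The cumulant function is at most linear near \<open>0\<close>, so \<open>cost \<theta>\<close> is of order \<open>\<theta>\<close> to the power
  \<open>1 / \<nu> > 1\<close> and is beaten by \<open>\<theta> x\<close> for small \<open>\<theta>\<close>.
\<close>

lemma rate_pos:
  assumes "0 < x"
  shows "0 < rate x"
proof -
  obtain \<theta>1 C where C: "0 < \<theta>1" "0 < C" "\<And>\<theta>. 0 \<le> \<theta> \<Longrightarrow> \<theta> \<le> \<theta>1 \<Longrightarrow> mgf \<theta> \<le> ennreal (exp (C * \<theta>))"
    using mgf_le_near_0 by blast
  define e where "e = 1 / \<nu> - 1"
  have e: "0 < e" using \<nu>_pos \<nu>_less_1 by (simp add: e_def)
  define d where "d = (x / C) powr (1 / e)"
  have "0 < d" using assms C by (simp add: d_def)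
  (* C * \<theta> < d is equivalent to (C * \<theta>) powr (1 / \<nu>) < x * \<theta>. *)
  define \<theta> where "\<theta> = min \<theta>1 (d / (2 * C))"
  have \<theta>: "0 < \<theta>" "\<theta> \<le> \<theta>1" "C * \<theta> < d"
    using C \<open>0 < d\<close> by (auto simp: \<theta>_def min_def field_simps split: if_splits)
  have "((C * \<theta>) powr (1 / \<nu>)) powr \<nu> = C * \<theta>" using \<theta> C \<nu>_pos by (simp add: powr_powr)
  then have adm: "admissible \<theta> ((C * \<theta>) powr (1 / \<nu>))" using C(3)[of \<theta>] \<theta> by (simp add: admissible_def)
  have "(C * \<theta>) powr (1 / \<nu>) = (C * \<theta>) powr (1 + e)" by (simp add: e_def)
  also have "\<dots> = C * \<theta> * (C * \<theta>) powr e" using \<theta> C by (simp add: powr_add)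
  also have "(C * \<theta>) powr e < d powr e" using \<theta> C e by (intro powr_less_mono2) auto
  then have "C * \<theta> * (C * \<theta>) powr e < C * \<theta> * d powr e" using \<theta> C by simp
  also have "d powr e = x / C" using e assms C by (simp add: d_def powr_powr)
  finally have "0 < \<theta> * x - (C * \<theta>) powr (1 / \<nu>)" using C by simp
  then have "0 < ereal (\<theta> * x - (C * \<theta>) powr (1 / \<nu>))" by (simp add: zero_ereal_def)
  also have "\<dots> \<le> rate x" by (rule rate_ge[OF adm])
  finally show ?thesis .
qed

text \<open>
  The rate is convex, vanishes at \<open>0\<close> and is positive and finite at \<open>x\<close>.  Convexity is used in the
  form \<open>rate x \<le> (x / x') rate x'\<close>.
\<close>

lemma rate_strict_mono:
  assumes "0 < x" "x < x'"
  shows "rate x < rate x'"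
proof -
  obtain r r' where r: "rate x = ereal r" "rate x' = ereal r'" using rate_finite by metis
  have "0 < r" using rate_pos[OF assms(1)] r by simp
  have "r \<le> x / x' * r'"
  proof (rule ccontr)
    assume "\<not> ?thesis"
    then have "ereal (x / x' * r') < rate x" using r by simp
    then obtain \<theta> \<xi> where adm: "admissible \<theta> \<xi>" and less: "x / x' * r' < \<theta> * x - \<xi>" by (rule less_rateE)
    have "\<theta> * x' - \<xi> \<le> r'" using rate_ge[OF adm, of x'] r by simp
    then have "x / x' * (\<theta> * x' - \<xi>) \<le> x / x' * r'" using assms by (intro mult_left_mono) auto
    moreover have "x / x' * (\<theta> * x' - \<xi>) = \<theta> * x - x / x' * \<xi>" using assms by (simp add: field_simps)
    moreover have "x / x' * \<xi> \<le> 1 * \<xi>" using assms adm by (intro mult_right_mono) (auto simp: admissible_def)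
    ultimately show False using less by simp
  qed
  then have "r * x' \<le> x * r'" using assms by (simp add: field_simps)
  have "r < r'"
  proof (rule ccontr)
    assume "\<not> r < r'"
    then have "x * r' \<le> x * r" using assms by simp
    also have "\<dots> < r * x'" using assms \<open>0 < r\<close> by simp
    finally show False using \<open>r * x' \<le> x * r'\<close> by simp
  qed
  then show ?thesis using r by simp
qed

text \<open>
  The supporting line at \<open>x\<close> is given by a pair \<open>(\<theta>, \<xi>)\<close> that is a limit of admissible ones, so the
  optimal exponent \<open>\<theta> x - \<xi>\<close> is at most \<open>rate x\<close>.
\<close>

lemma tail_product_ray:
  assumes "0 < x" "rate x < ereal c"
  shows "\<exists>n. \<exists>y>0. exp (- c * y) \<le> tail_product n (x * y) y"
proof -
  obtain k where k: "0 < tail_product k (x + 1) 1" using tail_product_pos by blast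
  obtain \<theta> \<xi> where \<theta>: "0 \<le> \<theta>" "0 \<le> \<xi>"
    and line: "\<And>n x y. 0 \<le> x \<Longrightarrow> 0 < y \<Longrightarrow> tail_product n x y \<le> exp (\<xi> * y - \<theta> * x)"
    and near: "\<And>\<epsilon>. 0 < \<epsilon> \<Longrightarrow> \<exists>n. \<exists>y>0. exp (y * (\<xi> - \<theta> * x - \<epsilon>)) \<le> tail_product n (x * y) y"
    by (rule supporting_line[where F = tail_product and ?x0.0 = x and z = "x + 1" and k = k])
      (use assms(1) k in \<open>auto intro: tail_product_nonneg tail_product_le_1
        tail_product_supermultiplicative tail_product_mono simp: tail_product_0\<close>)
  obtain c' where c': "rate x < ereal c'" "c' < c"
    using ereal_dense2[OF assms(2)] by auto
  have "0 < c'" using rate_nonneg[of x] c' by (metis ereal_less(2) le_less_trans)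
  have "\<theta> * x - \<xi> \<le> c'"
  proof (cases "\<theta> = 0")
    case True
    then show ?thesis using \<theta> \<open>0 < c'\<close> by simp
  next
    case False
    show ?thesis
    proof (rule ccontr)
      assume "\<not> ?thesis"
      then have gap: "0 < \<theta> * x - \<xi> - c'" by simp
      (* Moving to (\<theta> - \<delta>, \<xi> + \<delta>) costs \<delta> * (x + 1), which must not exceed the gap. *)
      define \<delta> where "\<delta> = min (\<theta> / 2) ((\<theta> * x - \<xi> - c') / (x + 1))"
      have "0 < \<delta>" using \<theta> False gap assms by (simp add: \<delta>_def)
      moreover have "\<delta> \<le> \<theta> / 2" unfolding \<delta>_def by (rule min.cobounded1)
      ultimately have \<delta>: "0 < \<delta>" "\<delta> < \<theta>" by linarith+
      have "\<delta> \<le> (\<theta> * x - \<xi> - c') / (x + 1)" by (simp add: \<delta>_def)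
      then have "\<delta> * (x + 1) \<le> \<theta> * x - \<xi> - c'" using assms by (simp add: le_divide_eq)
      then have "c' \<le> (\<theta> - \<delta>) * x - (\<xi> + \<delta>)" by (simp add: algebra_simps)
      moreover have "admissible (\<theta> - \<delta>) (\<xi> + \<delta>)"
        using \<delta> \<theta> line by (intro admissible_if_tail_product_le[of \<xi> \<theta>]) auto
      then have "ereal ((\<theta> - \<delta>) * x - (\<xi> + \<delta>)) \<le> rate x" by (rule rate_ge)
      ultimately have "ereal c' \<le> rate x" by (meson ereal_less_eq(3) order_trans)
      with c' show False by simp
    qed
  qed
  moreover obtain n y where "0 < y" "exp (y * (\<xi> - \<theta> * x - (c - c'))) \<le> tail_product n (x * y) y"
    using near[of "c - c'"] c' by auto
  ultimately have "- c \<le> \<xi> - \<theta> * x - (c - c')" "0 < y"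
    and near: "exp (y * (\<xi> - \<theta> * x - (c - c'))) \<le> tail_product n (x * y) y" by auto
  then have "y * (- c) \<le> y * (\<xi> - \<theta> * x - (c - c'))" by (intro mult_left_mono) auto
  then have "exp (- c * y) \<le> exp (y * (\<xi> - \<theta> * x - (c - c')))" by (simp add: mult.commute)
  with near \<open>0 < y\<close> show ?thesis by (blast intro: order_trans)
qed

text \<open>
  A good triple from \<open>tail_product_ray\<close> is multiplied by the integer part of \<open>t / y\<close>.  The passage from
  \<open>x\<close> to the smaller \<open>x1\<close> compensates for the rounding.
\<close>

lemma time_change_lower_tail:
  assumes "0 < x1" "x1 < x" "rate x < ereal c"
  shows "eventually (\<lambda>t. \<exists>n. exp (- c * t)
    \<le> prob {\<omega> \<in> space M. real n \<le> L t \<omega>} * prob {\<omega> \<in> space M. x1 * t \<le> S (real n) \<omega>}) at_top"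
proof -
  have "0 < x" "0 < c" using assms rate_nonneg[of x] by (auto, metis ereal_less(2) le_less_trans)
  obtain n y where y: "0 < y" "exp (- c * y) \<le> tail_product n (x * y) y"
    using tail_product_ray[OF \<open>0 < x\<close> assms(3)] by blast
  have "eventually (\<lambda>t. max y (x * y / (x - x1)) \<le> t) at_top" by (rule eventually_ge_at_top)
  then show ?thesis
  proof eventually_elim
    case (elim t)
    then have t: "y \<le> t" "x * y / (x - x1) \<le> t" by auto
    define N where "N = nat \<lfloor>t / y\<rfloor>"
    have "1 \<le> t / y" using t y by simp
    then have "0 < N" "real N \<le> t / y" "t / y - 1 \<le> real N" unfolding N_def by linarith+
    then have N: "0 < N" "real N * y \<le> t" "t - y \<le> real N * y" using y by (auto simp: field_simps)
    have "x * y \<le> t * (x - x1)" using t assms by (simp add: divide_le_eq)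
    then have "x1 * t \<le> x * (t - y)" by (simp add: algebra_simps)
    also have "\<dots> \<le> x * (real N * y)" using N \<open>0 < x\<close> by simp
    finally have x1: "x1 * t \<le> real N * (x * y)" by (simp add: mult_ac)
    have "exp (- c * t) \<le> exp (- c * (real N * y))" using N \<open>0 < c\<close> by simp
    also have "\<dots> = exp (- c * y) ^ N" by (simp flip: exp_of_nat_mult add: mult_ac)
    also have "\<dots> \<le> tail_product n (x * y) y ^ N" using y by (intro power_mono) auto
    also have "\<dots> \<le> tail_product (N * n) (real N * (x * y)) (real N * y)"
      using N y \<open>0 < x\<close> tail_product_nonneg tail_product_supermultiplicative
      by (intro supermultiplicative_power) auto
    also have "\<dots> \<le> tail_product (N * n) (x1 * t) t" using x1 N by (intro tail_product_mono)
    also have "\<dots> \<le> prob {\<omega> \<in> space M. x1 * t \<le> S (real (N * n)) \<omega>} * prob {\<omega> \<in> space M. real (N * n) \<le> L t \<omega>}"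
      unfolding tail_product_def using t y by (intro mult_left_mono prob_L_ge_ge) auto
    finally show ?case by (auto simp: mult.commute intro!: exI[of _ "N * n"])
  qed
qed

text \<open>
  The Chernoff bound at the almost optimal pair; the slack in \<open>c < \<theta> a - \<xi>\<close> is exactly the room
  between \<open>\<xi>\<close> and \<open>\<xi>' = \<theta> a - c\<close>.
\<close>

lemma chernoff_rate:
  assumes "ereal c < rate a"
  shows "\<exists>K\<ge>0. \<forall>t E. 0 \<le> t \<longrightarrow> decoupled t E \<longrightarrow>
    prob (E \<inter> {\<omega> \<in> space M. a * t \<le> time_change t \<omega>}) \<le> K * exp (- c * t) * prob E"
proof -
  obtain \<theta> \<xi> where adm: "admissible \<theta> \<xi>" and "c < \<theta> * a - \<xi>" using assms by (rule less_rateE)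
  then have "\<xi> < \<theta> * a - c" by simp
  from chernoff[OF adm this] obtain K where K: "0 \<le> K"
    "\<And>t b E. 0 \<le> t \<Longrightarrow> decoupled t E \<Longrightarrow>
      prob (E \<inter> {\<omega> \<in> space M. b \<le> time_change t \<omega>}) \<le> K * exp ((\<theta> * a - c) * t - \<theta> * b) * prob E"
    by blast
  have "prob (E \<inter> {\<omega> \<in> space M. a * t \<le> time_change t \<omega>}) \<le> K * exp (- c * t) * prob E"
    if "0 \<le> t" "decoupled t E" for t E
    using K(2)[OF that, of "a * t"] by (simp add: algebra_simps)
  with K(1) show ?thesis by blast
qed

end

section \<open>The difference of two independent time changes\<close>

text \<open>
  The two summands on one probability space.  Independence is demanded only for the functionals that
  are integrated below, with one common time for \<open>L1\<close> and \<open>L2\<close> and integer times for \<open>S1\<close> and \<open>S2\<close>.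
\<close>

locale two_sided_time_change = prob_space M +
    A: time_changed_subordinator M S1 H1 L1 \<nu>1 + B: time_changed_subordinator M S2 H2 L2 \<nu>2
  for M :: "'a measure" and S1 H1 L1 :: "real \<Rightarrow> 'a \<Rightarrow> real" and \<nu>1 :: real
    and S2 H2 L2 :: "real \<Rightarrow> 'a \<Rightarrow> real" and \<nu>2 :: real +
  assumes independence: "\<And>t n m f1 f2 g1 g2. 0 \<le> t \<Longrightarrow>
    f1 \<in> borel_measurable borel \<Longrightarrow> f2 \<in> borel_measurable borel \<Longrightarrow>
    g1 \<in> borel_measurable borel \<Longrightarrow> g2 \<in> borel_measurable borel \<Longrightarrow>
    (\<integral>\<^sup>+\<omega>. f1 (L1 t \<omega>) * f2 (L2 t \<omega>) * (g1 (S1 (real n) \<omega>) * g2 (S2 (real m) \<omega>)) \<partial>M) =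
    (\<integral>\<^sup>+\<omega>. f1 (L1 t \<omega>) \<partial>M) * (\<integral>\<^sup>+\<omega>. f2 (L2 t \<omega>) \<partial>M) *
    ((\<integral>\<^sup>+\<omega>. g1 (S1 (real n) \<omega>) \<partial>M) * (\<integral>\<^sup>+\<omega>. g2 (S2 (real m) \<omega>) \<partial>M) :: ennreal)"
begin

text \<open>
  Statements about the negative half-line follow from those about the positive one by this symmetry.
\<close>

lemma swapped: "two_sided_time_change M S2 H2 L2 \<nu>2 S1 H1 L1 \<nu>1"
proof unfold_locales
  fix t :: real and n m and f1 f2 g1 g2 :: "real \<Rightarrow> ennreal"
  assume t: "0 \<le> t" and meas: "f1 \<in> borel_measurable borel" "f2 \<in> borel_measurable borel"
    "g1 \<in> borel_measurable borel" "g2 \<in> borel_measurable borel"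
  show "(\<integral>\<^sup>+\<omega>. f1 (L2 t \<omega>) * f2 (L1 t \<omega>) * (g1 (S2 (real n) \<omega>) * g2 (S1 (real m) \<omega>)) \<partial>M) =
    (\<integral>\<^sup>+\<omega>. f1 (L2 t \<omega>) \<partial>M) * (\<integral>\<^sup>+\<omega>. f2 (L1 t \<omega>) \<partial>M) *
    ((\<integral>\<^sup>+\<omega>. g1 (S2 (real n) \<omega>) \<partial>M) * (\<integral>\<^sup>+\<omega>. g2 (S1 (real m) \<omega>) \<partial>M))"
    using independence[OF t meas(2,1,4,3), of m n] by (simp add: mult_ac)
qed

lemma decoupled_space:
  assumes "0 \<le> t"
  shows "A.decoupled t (space M)"
  unfolding A.decoupled_def
proof (intro conjI allI impI)
  fix n and f g :: "real \<Rightarrow> ennreal"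
  assume meas: "f \<in> borel_measurable borel" "g \<in> borel_measurable borel"
  have "(\<integral>\<^sup>+\<omega>. indicator (space M) \<omega> * (f (L1 t \<omega>) * g (S1 (real n) \<omega>)) \<partial>M)
      = (\<integral>\<^sup>+\<omega>. f (L1 t \<omega>) * 1 * (g (S1 (real n) \<omega>) * 1) \<partial>M)"
    by (intro nn_integral_cong) simp
  also have "\<dots> = (\<integral>\<^sup>+\<omega>. f (L1 t \<omega>) \<partial>M) * (\<integral>\<^sup>+\<omega>. g (S1 (real n) \<omega>) \<partial>M)"
    using independence[OF assms meas(1) _ meas(2), of "\<lambda>_. 1" "\<lambda>_. 1" n 0] by (simp add: emeasure_space_1)
  finally show "(\<integral>\<^sup>+\<omega>. indicator (space M) \<omega> * (f (L1 t \<omega>) * g (S1 (real n) \<omega>)) \<partial>M)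
      = emeasure M (space M) * ((\<integral>\<^sup>+\<omega>. f (L1 t \<omega>) \<partial>M) * (\<integral>\<^sup>+\<omega>. g (S1 (real n) \<omega>) \<partial>M))"
    by (simp add: emeasure_space_1)
qed simp

text \<open>
  An event on which the first summand is almost surely at least \<open>x\<close> at time \<open>t\<close>.  It involves \<open>S1\<close>
  at a fixed time only, so its independence of the second summand is immediate.
\<close>

definition reach :: "real \<Rightarrow> nat \<Rightarrow> real \<Rightarrow> 'a set" where
  "reach t n x = {\<omega> \<in> space M. real n \<le> L1 t \<omega> \<and> x \<le> S1 (real n) \<omega>}"

lemma nn_integral_reach:
  assumes "0 \<le> t" "f \<in> borel_measurable borel" "g \<in> borel_measurable borel"
  shows "(\<integral>\<^sup>+\<omega>. indicator (reach t n x) \<omega> * (f (L2 t \<omega>) * g (S2 (real m) \<omega>)) \<partial>M)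
    = ennreal (prob {\<omega> \<in> space M. real n \<le> L1 t \<omega>} * prob {\<omega> \<in> space M. x \<le> S1 (real n) \<omega>})
      * ((\<integral>\<^sup>+\<omega>. f (L2 t \<omega>) \<partial>M) * (\<integral>\<^sup>+\<omega>. g (S2 (real m) \<omega>) \<partial>M))"
proof -
  note [measurable] = A.L_measurable[OF assms(1)] A.S_measurable[of "real n" for n, simplified]
  have "(\<integral>\<^sup>+\<omega>. indicator {real n..} (L1 t \<omega>) \<partial>M) = (\<integral>\<^sup>+\<omega>. indicator {\<omega> \<in> space M. real n \<le> L1 t \<omega>} \<omega> \<partial>M)"
    by (intro nn_integral_cong) (auto simp: indicator_def)
  then have L: "(\<integral>\<^sup>+\<omega>. indicator {real n..} (L1 t \<omega>) \<partial>M) = ennreal (prob {\<omega> \<in> space M. real n \<le> L1 t \<omega>})"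
    by (simp add: emeasure_eq_measure)
  have "(\<integral>\<^sup>+\<omega>. indicator {x..} (S1 (real n) \<omega>) \<partial>M) = (\<integral>\<^sup>+\<omega>. indicator {\<omega> \<in> space M. x \<le> S1 (real n) \<omega>} \<omega> \<partial>M)"
    by (intro nn_integral_cong) (auto simp: indicator_def)
  then have S: "(\<integral>\<^sup>+\<omega>. indicator {x..} (S1 (real n) \<omega>) \<partial>M) = ennreal (prob {\<omega> \<in> space M. x \<le> S1 (real n) \<omega>})"
    by (simp add: emeasure_eq_measure)
  have "(\<integral>\<^sup>+\<omega>. indicator (reach t n x) \<omega> * (f (L2 t \<omega>) * g (S2 (real m) \<omega>)) \<partial>M)
    = (\<integral>\<^sup>+\<omega>. indicator {real n..} (L1 t \<omega>) * f (L2 t \<omega>) * (indicator {x..} (S1 (real n) \<omega>) * g (S2 (real m) \<omega>)) \<partial>M)"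
    by (intro nn_integral_cong) (auto simp: reach_def indicator_def)
  also have "\<dots> = ennreal (prob {\<omega> \<in> space M. real n \<le> L1 t \<omega>}) * (\<integral>\<^sup>+\<omega>. f (L2 t \<omega>) \<partial>M) *
      (ennreal (prob {\<omega> \<in> space M. x \<le> S1 (real n) \<omega>}) * (\<integral>\<^sup>+\<omega>. g (S2 (real m) \<omega>) \<partial>M))"
    unfolding L[symmetric] S[symmetric] using assms by (intro independence) auto
  finally show ?thesis by (simp add: ennreal_mult mult_ac)
qed

lemma reach_measurable:
  assumes "0 \<le> t"
  shows "reach t n x \<in> events"
proof -
  note [measurable] = A.L_measurable[OF assms] A.S_measurable[of "real n" for n, simplified]
  show ?thesis unfolding reach_def by measurable
qed

lemma prob_reach:
  assumes "0 \<le> t"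
  shows "prob (reach t n x) = prob {\<omega> \<in> space M. real n \<le> L1 t \<omega>} * prob {\<omega> \<in> space M. x \<le> S1 (real n) \<omega>}"
proof -
  have "ennreal (prob (reach t n x)) = (\<integral>\<^sup>+\<omega>. indicator (reach t n x) \<omega> \<partial>M)"
    using reach_measurable[OF assms] by (simp add: emeasure_eq_measure)
  also have "\<dots> = ennreal (prob {\<omega> \<in> space M. real n \<le> L1 t \<omega>} * prob {\<omega> \<in> space M. x \<le> S1 (real n) \<omega>})"
    using nn_integral_reach[OF assms, of "\<lambda>_. 1" "\<lambda>_. 1" n x 0] by (simp add: emeasure_space_1)
  finally show ?thesis by simp
qed

lemma decoupled_reach:
  assumes "0 \<le> t"
  shows "B.decoupled t (reach t n x)"
  unfolding B.decoupled_def
  using assms reach_measurable[OF assms] by (auto simp: nn_integral_reach emeasure_eq_measure prob_reach)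

definition average :: "real \<Rightarrow> 'a \<Rightarrow> real" where
  "average t \<omega> = (A.time_change t \<omega> - B.time_change t \<omega>) / t"

lemma average_measurable:
  assumes "0 \<le> t"
  shows "average t \<in> borel_measurable M"
proof -
  note [measurable] = A.time_change_measurable[OF assms] B.time_change_measurable[OF assms]
  show ?thesis unfolding average_def[abs_def] by measurable
qed

text \<open>
  The part of \<open>C\<close> in the half-line has a least element \<open>a\<close>, and \<open>average t \<ge> a\<close> implies that the first
  summand is at least \<open>a t\<close>.
\<close>

lemma prob_closed_nonneg_le:
  assumes C: "closed C" and c: "\<And>x. x \<in> C \<Longrightarrow> 0 \<le> x \<Longrightarrow> ereal c < A.rate x"
  shows "\<exists>K\<ge>0. \<forall>t>0. prob {\<omega> \<in> space M. average t \<omega> \<in> C \<and> 0 \<le> average t \<omega>} \<le> K * exp (- c * t)"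
proof (cases "C \<inter> {0..} = {}")
  case True
  then have empty: "{\<omega> \<in> space M. average t \<omega> \<in> C \<and> 0 \<le> average t \<omega>} = {}" for t by auto
  show ?thesis unfolding empty by (intro exI[of _ 0]) simp
next
  case False
  define a where "a = Inf (C \<inter> {0..})"
  have bdd: "bdd_below (C \<inter> {0..})" by (rule bdd_belowI[of _ 0]) simp
  then have "a \<in> C \<inter> {0..}"
    unfolding a_def using C False by (intro closed_contains_Inf closed_Int) auto
  then have "ereal c < A.rate a" using c by simp
  then obtain K where K: "0 \<le> K" "\<And>t E. 0 \<le> t \<Longrightarrow> A.decoupled t E \<Longrightarrow>
      prob (E \<inter> {\<omega> \<in> space M. a * t \<le> A.time_change t \<omega>}) \<le> K * exp (- c * t) * prob E"
    using A.chernoff_rate by blast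
  have "prob {\<omega> \<in> space M. average t \<omega> \<in> C \<and> 0 \<le> average t \<omega>} \<le> K * exp (- c * t)" if t: "0 < t" for t
  proof -
    note [measurable] = A.time_change_measurable[OF less_imp_le[OF t]]
    have "prob {\<omega> \<in> space M. average t \<omega> \<in> C \<and> 0 \<le> average t \<omega>} \<le> prob (space M \<inter> {\<omega> \<in> space M. a * t \<le> A.time_change t \<omega>})"
    proof (rule finite_measure_mono_AE)
      show "AE \<omega> in M. \<omega> \<in> {\<omega> \<in> space M. average t \<omega> \<in> C \<and> 0 \<le> average t \<omega>}
        \<longrightarrow> \<omega> \<in> space M \<inter> {\<omega> \<in> space M. a * t \<le> A.time_change t \<omega>}"
        using B.time_change_nonneg[OF less_imp_le[OF t]]
      proof eventually_elim
        case (elim \<omega>)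
        have "a * t \<le> A.time_change t \<omega>" if "average t \<omega> \<in> C" "0 \<le> average t \<omega>"
        proof -
          have "a \<le> average t \<omega>" unfolding a_def using bdd that by (intro cInf_lower) auto
          then have "a * t \<le> A.time_change t \<omega> - B.time_change t \<omega>"
            using t by (simp add: average_def le_divide_eq)
          with elim show ?thesis by simp
        qed
        then show ?case by auto
      qed
    qed measurable
    also have "\<dots> \<le> K * exp (- c * t) * prob (space M)"
      using t decoupled_space[of t] by (intro K) auto
    finally show ?thesis by (simp add: prob_space)
  qed
  then show ?thesis using K(1) by blast
qed

lemma prob_closed_le:
  assumes C: "closed C" and c1: "\<And>x. x \<in> C \<Longrightarrow> 0 \<le> x \<Longrightarrow> ereal c < A.rate x"
    and c2: "\<And>x. x \<in> C \<Longrightarrow> x \<le> 0 \<Longrightarrow> ereal c < B.rate (- x)"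
  shows "\<exists>K. \<forall>t>0. prob {\<omega> \<in> space M. average t \<omega> \<in> C} \<le> K * exp (- c * t)"
proof -
  interpret T: two_sided_time_change M S2 H2 L2 \<nu>2 S1 H1 L1 \<nu>1 by (rule swapped)
  have T_average: "T.average t \<omega> = - average t \<omega>" for t \<omega>
    by (simp add: average_def T.average_def minus_divide_left)
  obtain K1 where K1: "\<And>t. 0 < t \<Longrightarrow> prob {\<omega> \<in> space M. average t \<omega> \<in> C \<and> 0 \<le> average t \<omega>} \<le> K1 * exp (- c * t)"
    using prob_closed_nonneg_le[OF C c1] by blast
  have "closed (uminus ` C)" using C by (rule closed_negations)
  from T.prob_closed_nonneg_le[OF this, of c] obtain K2 where
    "\<And>t. 0 < t \<Longrightarrow> prob {\<omega> \<in> space M. - average t \<omega> \<in> uminus ` C \<and> 0 \<le> - average t \<omega>} \<le> K2 * exp (- c * t)"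
    using c2 unfolding T_average by force
  then have K2: "prob {\<omega> \<in> space M. average t \<omega> \<in> C \<and> average t \<omega> \<le> 0} \<le> K2 * exp (- c * t)" if "0 < t" for t
    using that by (simp add: inj_image_mem_iff)
  have "prob {\<omega> \<in> space M. average t \<omega> \<in> C} \<le> (K1 + K2) * exp (- c * t)" if t: "0 < t" for t
  proof -
    note [measurable] = average_measurable[OF less_imp_le[OF t]] borel_closed[OF C]
    have "prob {\<omega> \<in> space M. average t \<omega> \<in> C}
      \<le> prob ({\<omega> \<in> space M. average t \<omega> \<in> C \<and> 0 \<le> average t \<omega>} \<union> {\<omega> \<in> space M. average t \<omega> \<in> C \<and> average t \<omega> \<le> 0})"
      by (intro finite_measure_mono) auto
    also have "\<dots> \<le> prob {\<omega> \<in> space M. average t \<omega> \<in> C \<and> 0 \<le> average t \<omega>} + prob {\<omega> \<in> space M. average t \<omega> \<in> C \<and> average t \<omega> \<le> 0}"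
      by (intro measure_subadditive) (auto simp: emeasure_eq_measure)
    also have "\<dots> \<le> K1 * exp (- c * t) + K2 * exp (- c * t)" by (intro add_mono K1 K2 t)
    finally show ?thesis by (simp add: distrib_right)
  qed
  then show ?thesis by blast
qed

text \<open>
  For the average to be near \<open>x\<close> it suffices that the first summand is at least \<open>(x - \<epsilon>) t\<close>, but not as
  large as \<open>(x + \<epsilon>) t\<close>, and that the second one is below \<open>\<epsilon> t\<close>.  The first condition is ensured by
  \<open>reach\<close>, whose probability decays with a rate close to \<open>rate x\<close>.  Violating the second one is more
  expensive, because the rate is strictly increasing.  Violating the third one has vanishing
  probability even conditionally on \<open>reach\<close>.
\<close>

lemma prob_open_pos_ge:
  assumes U: "open U" "x \<in> U" and "0 < x" and c: "A.rate x < ereal c"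
  shows "eventually (\<lambda>t. exp (- c * t) \<le> prob {\<omega> \<in> space M. average t \<omega> \<in> U}) at_top"
proof -
  obtain e where e: "0 < e" "\<And>y. \<bar>y - x\<bar> < e \<Longrightarrow> y \<in> U"
    using U by (metis open_real)
  define \<epsilon> where "\<epsilon> = min (e / 3) (x / 3)"
  have \<epsilon>: "0 < \<epsilon>" "3 * \<epsilon> \<le> e" "3 * \<epsilon> \<le> x" using e \<open>0 < x\<close> by (auto simp: \<epsilon>_def)
  (* c1 is the rate granted to the event reach, d a faster rate for overshooting (x + \<epsilon>) * t, and
     c2 a rate for the second summand reaching \<epsilon> * t. *)
  have "A.rate x < A.rate (x + \<epsilon>)" using \<open>0 < x\<close> \<epsilon> by (intro A.rate_strict_mono) auto
  then have "A.rate x < min (ereal c) (A.rate (x + \<epsilon>))" using c by simp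
  then obtain c1 where c1: "A.rate x < ereal c1" "ereal c1 < min (ereal c) (A.rate (x + \<epsilon>))"
    using ereal_dense2 by blast
  then obtain d where d: "c1 < d" "ereal d < A.rate (x + \<epsilon>)"
    using ereal_dense2[of "ereal c1" "A.rate (x + \<epsilon>)"] by auto
  obtain c2 where c2: "0 < c2" "ereal c2 < B.rate \<epsilon>"
    using ereal_dense2[OF B.rate_pos[OF \<epsilon>(1)]] by auto
  obtain K1 where K1: "\<And>t E. 0 \<le> t \<Longrightarrow> A.decoupled t E \<Longrightarrow>
      prob (E \<inter> {\<omega> \<in> space M. (x + \<epsilon>) * t \<le> A.time_change t \<omega>}) \<le> K1 * exp (- d * t) * prob E"
    using A.chernoff_rate[OF d(2)] by blast
  obtain K2 where K2: "\<And>t E. 0 \<le> t \<Longrightarrow> B.decoupled t E \<Longrightarrow>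
      prob (E \<inter> {\<omega> \<in> space M. \<epsilon> * t \<le> B.time_change t \<omega>}) \<le> K2 * exp (- c2 * t) * prob E"
    using B.chernoff_rate[OF c2(2)] by blast
  have "eventually (\<lambda>t. K2 * exp (- c2 * t) \<le> 1 / 4) at_top"
    using c2 by (intro eventually_exp_small) auto
  moreover have "eventually (\<lambda>t. K1 * exp (- (d - c1) * t) \<le> 1 / 4) at_top"
    using d by (intro eventually_exp_small) auto
  moreover have "eventually (\<lambda>t. 1 * exp (- (c - c1) * t) \<le> 1 / 2) at_top"
    using c1 by (intro eventually_exp_small) auto
  moreover have "eventually (\<lambda>t. \<exists>n. exp (- c1 * t) \<le>
      prob {\<omega> \<in> space M. real n \<le> L1 t \<omega>} * prob {\<omega> \<in> space M. (x - \<epsilon>) * t \<le> S1 (real n) \<omega>}) at_top"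
    using \<epsilon> c1 by (intro A.time_change_lower_tail[of "x - \<epsilon>" x]) auto
  ultimately show ?thesis
    using eventually_gt_at_top[of 0]
  proof eventually_elim
    case (elim t)
    then have t: "0 < t" "0 \<le> t" by auto
    note [measurable] = average_measurable[OF t(2)] A.time_change_measurable[OF t(2)] B.time_change_measurable[OF t(2)]
      reach_measurable[OF t(2)] borel_open[OF U(1)]
    obtain n where n: "exp (- c1 * t) \<le> prob (reach t n ((x - \<epsilon>) * t))"
      using elim prob_reach[OF t(2)] by auto
    define E where "E = reach t n ((x - \<epsilon>) * t)"
    have [measurable]: "E \<in> events" by (simp add: E_def)
    define V where "V = {\<omega> \<in> space M. average t \<omega> \<in> U}"
    define F where "F = E \<inter> {\<omega> \<in> space M. \<epsilon> * t \<le> B.time_change t \<omega>}"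
    define G where "G = space M \<inter> {\<omega> \<in> space M. (x + \<epsilon>) * t \<le> A.time_change t \<omega>}"
    have [measurable]: "V \<in> events" "F \<in> events" "G \<in> events"
      unfolding V_def F_def G_def by measurable
    have "prob E \<le> prob (V \<union> (F \<union> G))"
    proof (rule finite_measure_mono_AE)
      show "AE \<omega> in M. \<omega> \<in> E \<longrightarrow> \<omega> \<in> V \<union> (F \<union> G)"
        using A.time_change_ge[OF t(2), of n] B.time_change_nonneg[OF t(2)]
      proof eventually_elim
        case (elim \<omega>)
        show ?case
        proof
          assume \<omega>: "\<omega> \<in> E"
          then have "\<omega> \<in> space M" "(x - \<epsilon>) * t \<le> A.time_change t \<omega>" using elim by (auto simp: E_def reach_def)
          moreover have "average t \<omega> \<in> U"
            if "\<not> \<epsilon> * t \<le> B.time_change t \<omega>" "\<not> (x + \<epsilon>) * t \<le> A.time_change t \<omega>"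
          proof -
            have "(x - 2 * \<epsilon>) * t < A.time_change t \<omega> - B.time_change t \<omega>"
              "A.time_change t \<omega> - B.time_change t \<omega> < (x + \<epsilon>) * t"
              using that \<open>(x - \<epsilon>) * t \<le> A.time_change t \<omega>\<close> elim by (auto simp: algebra_simps)
            then have "x - 2 * \<epsilon> < average t \<omega>" "average t \<omega> < x + \<epsilon>"
              using t by (auto simp: average_def less_divide_eq divide_less_eq)
            then show ?thesis using \<epsilon> by (intro e(2)) auto
          qed
          ultimately show "\<omega> \<in> V \<union> (F \<union> G)" using \<omega> by (auto simp: V_def F_def G_def)
        qed
      qed
    qed measurable
    also have "\<dots> \<le> prob V + prob (F \<union> G)"
      by (intro measure_subadditive) (auto simp: emeasure_eq_measure)
    also have "prob (F \<union> G) \<le> prob F + prob G"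
      by (intro measure_subadditive) (auto simp: emeasure_eq_measure)
    finally have "prob E \<le> prob V + (prob F + prob G)" by simp
    moreover have "prob F \<le> 1 / 4 * prob E"
    proof -
      have "prob F \<le> K2 * exp (- c2 * t) * prob E"
        unfolding F_def E_def by (intro K2 decoupled_reach t)
      also have "\<dots> \<le> 1 / 4 * prob E" using elim by (intro mult_right_mono) auto
      finally show ?thesis .
    qed
    moreover have "prob G \<le> 1 / 4 * exp (- c1 * t)"
    proof -
      have "prob G \<le> K1 * exp (- d * t) * prob (space M)"
        unfolding G_def by (intro K1 decoupled_space t)
      also have "\<dots> = K1 * exp (- (d - c1) * t) * exp (- c1 * t)"
        by (simp add: prob_space mult.assoc algebra_simps flip: exp_add)
      also have "\<dots> \<le> 1 / 4 * exp (- c1 * t)" using elim by (intro mult_right_mono) auto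
      finally show ?thesis .
    qed
    moreover have "exp (- c1 * t) \<le> prob E" using n by (simp add: E_def)
    ultimately have "1 / 2 * exp (- c1 * t) \<le> prob V" by simp
    moreover have "exp (- c * t) \<le> 1 / 2 * exp (- c1 * t)"
    proof -
      have "exp (- c * t) = 1 * exp (- (c - c1) * t) * exp (- c1 * t)"
        by (simp add: algebra_simps flip: exp_add)
      also have "\<dots> \<le> 1 / 2 * exp (- c1 * t)" using elim by (intro mult_right_mono) auto
      finally show ?thesis .
    qed
    ultimately show ?case by (simp add: V_def)
  qed
qed

text \<open>
  Both summands divided by \<open>t\<close> tend to \<open>0\<close> in probability, since their rates are positive away from
  \<open>0\<close>.
\<close>

lemma prob_open_0_ge:
  assumes U: "open U" "0 \<in> U" and c: "0 < c"
  shows "eventually (\<lambda>t. exp (- c * t) \<le> prob {\<omega> \<in> space M. average t \<omega> \<in> U}) at_top"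
proof -
  interpret T: two_sided_time_change M S2 H2 L2 \<nu>2 S1 H1 L1 \<nu>1 by (rule swapped)
  obtain \<epsilon> where \<epsilon>: "0 < \<epsilon>" "\<And>y. \<bar>y - 0\<bar> < \<epsilon> \<Longrightarrow> y \<in> U"
    using U by (metis open_real)
  obtain c1 where c1: "0 < c1" "ereal c1 < A.rate \<epsilon>"
    using ereal_dense2[OF A.rate_pos[OF \<epsilon>(1)]] by auto
  obtain c2 where c2: "0 < c2" "ereal c2 < B.rate \<epsilon>"
    using ereal_dense2[OF B.rate_pos[OF \<epsilon>(1)]] by auto
  obtain K1 where K1: "\<And>t E. 0 \<le> t \<Longrightarrow> A.decoupled t E \<Longrightarrow>
      prob (E \<inter> {\<omega> \<in> space M. \<epsilon> * t \<le> A.time_change t \<omega>}) \<le> K1 * exp (- c1 * t) * prob E"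
    using A.chernoff_rate[OF c1(2)] by blast
  obtain K2 where K2: "\<And>t E. 0 \<le> t \<Longrightarrow> B.decoupled t E \<Longrightarrow>
      prob (E \<inter> {\<omega> \<in> space M. \<epsilon> * t \<le> B.time_change t \<omega>}) \<le> K2 * exp (- c2 * t) * prob E"
    using B.chernoff_rate[OF c2(2)] by blast
  have "eventually (\<lambda>t. K1 * exp (- c1 * t) \<le> 1 / 4) at_top"
    using c1 by (intro eventually_exp_small) auto
  moreover have "eventually (\<lambda>t. K2 * exp (- c2 * t) \<le> 1 / 4) at_top"
    using c2 by (intro eventually_exp_small) auto
  moreover have "eventually (\<lambda>t. 1 * exp (- c * t) \<le> 1 / 2) at_top"
    using c by (intro eventually_exp_small) auto
  ultimately show ?thesis
    using eventually_gt_at_top[of 0]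
  proof eventually_elim
    case (elim t)
    then have t: "0 < t" "0 \<le> t" by auto
    note [measurable] = average_measurable[OF t(2)] A.time_change_measurable[OF t(2)] B.time_change_measurable[OF t(2)]
      borel_open[OF U(1)]
    define V where "V = {\<omega> \<in> space M. average t \<omega> \<in> U}"
    define F where "F = space M \<inter> {\<omega> \<in> space M. \<epsilon> * t \<le> A.time_change t \<omega>}"
    define G where "G = space M \<inter> {\<omega> \<in> space M. \<epsilon> * t \<le> B.time_change t \<omega>}"
    have [measurable]: "V \<in> events" "F \<in> events" "G \<in> events"
      unfolding V_def F_def G_def by measurable
    have "prob (space M) \<le> prob (V \<union> (F \<union> G))"
    proof (rule finite_measure_mono_AE)
      show "AE \<omega> in M. \<omega> \<in> space M \<longrightarrow> \<omega> \<in> V \<union> (F \<union> G)"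
        using A.time_change_nonneg[OF t(2)] B.time_change_nonneg[OF t(2)]
      proof eventually_elim
        case (elim \<omega>)
        have "average t \<omega> \<in> U"
          if "\<not> \<epsilon> * t \<le> A.time_change t \<omega>" "\<not> \<epsilon> * t \<le> B.time_change t \<omega>"
        proof -
          have "(- \<epsilon>) * t < A.time_change t \<omega> - B.time_change t \<omega>"
            "A.time_change t \<omega> - B.time_change t \<omega> < \<epsilon> * t"
            using that elim by auto
          then have "- \<epsilon> < average t \<omega>" "average t \<omega> < \<epsilon>"
            using t by (auto simp only: average_def less_divide_eq divide_less_eq if_True)
          then show ?thesis by (intro \<epsilon>(2)) auto
        qed
        then show ?case by (auto simp: V_def F_def G_def)
      qed
    qed measurable
    also have "\<dots> \<le> prob V + prob (F \<union> G)"
      by (intro measure_subadditive) (auto simp: emeasure_eq_measure)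
    also have "prob (F \<union> G) \<le> prob F + prob G"
      by (intro measure_subadditive) (auto simp: emeasure_eq_measure)
    finally have "1 \<le> prob V + (prob F + prob G)" by (simp add: prob_space)
    moreover have "prob F \<le> K1 * exp (- c1 * t) * prob (space M)"
      unfolding F_def by (intro K1 decoupled_space t)
    moreover have "prob G \<le> K2 * exp (- c2 * t) * prob (space M)"
      unfolding G_def by (intro K2 T.decoupled_space t)
    ultimately show ?case using elim by (simp add: V_def prob_space)
  qed
qed

lemma prob_open_ge:
  assumes U: "open U" "x \<in> U" and c1: "0 \<le> x \<Longrightarrow> A.rate x < ereal c"
    and c2: "x \<le> 0 \<Longrightarrow> B.rate (- x) < ereal c"
  shows "eventually (\<lambda>t. exp (- c * t) \<le> prob {\<omega> \<in> space M. average t \<omega> \<in> U}) at_top"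
proof (cases x "0 :: real" rule: linorder_cases)
  case less
  interpret T: two_sided_time_change M S2 H2 L2 \<nu>2 S1 H1 L1 \<nu>1 by (rule swapped)
  have T_average: "T.average t \<omega> = - average t \<omega>" for t \<omega>
    by (simp add: average_def T.average_def minus_divide_left)
  have "open (uminus ` U)" using U(1) by (rule open_negations)
  then have "eventually (\<lambda>t. exp (- c * t) \<le> prob {\<omega> \<in> space M. T.average t \<omega> \<in> uminus ` U}) at_top"
    using less U c2 by (intro T.prob_open_pos_ge[of _ "- x"]) auto
  then show ?thesis by (simp add: T_average inj_image_mem_iff)
next
  case equal
  then show ?thesis using U c1 by (intro prob_open_0_ge) (auto simp: A.rate_0)
next
  case greater
  then show ?thesis using U c1 by (intro prob_open_pos_ge[of _ x]) auto
qed

end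

section \<open>The large deviation principle\<close>

context two_sided_time_change
begin

text \<open>
  An explicit form of the Legendre transform of \<open>\<Psi>\<close>, see \<open>legendre_eq\<close>.
\<close>

definition two_sided_rate :: "real \<Rightarrow> ereal" where
  "two_sided_rate x = (if 0 \<le> x then A.rate x else B.rate (- x))"

lemma Psi_eq:
  "Psi \<nu>1 \<nu>2 (log_mgf M (S1 1)) (log_mgf M (S2 1)) \<theta> = (if 0 \<le> \<theta> then A.cost \<theta> else B.cost (- \<theta>))"
  by (simp add: Psi_def A.cost_def B.cost_def)

text \<open>
  If \<open>\<theta>\<close> and \<open>x\<close> have opposite signs, then \<open>\<theta> x - \<Psi> \<theta> \<le> 0\<close>, while \<open>\<theta> = 0\<close> always contributes \<open>0\<close>.
\<close>

lemma legendre_eq: "legendre_transform (Psi \<nu>1 \<nu>2 (log_mgf M (S1 1)) (log_mgf M (S2 1))) = two_sided_rate"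
proof
  fix x :: real
  let ?P = "Psi \<nu>1 \<nu>2 (log_mgf M (S1 1)) (log_mgf M (S2 1))"
  have neg: "ereal (\<theta> * x) - c \<le> 0" if "\<theta> * x \<le> 0" "0 \<le> c" for \<theta> c
    using that by (cases c) auto
  show "legendre_transform ?P x = two_sided_rate x"
    unfolding legendre_transform_def
  proof (rule antisym)
    show "(SUP \<theta>. ereal (\<theta> * x) - ?P \<theta>) \<le> two_sided_rate x"
    proof (rule SUP_least)
      fix \<theta> :: real
      consider "0 \<le> x" "0 \<le> \<theta>" | "0 \<le> x" "\<theta> < 0" | "x < 0" "0 \<le> \<theta>" | "x < 0" "\<theta> < 0" by linarith
      then show "ereal (\<theta> * x) - ?P \<theta> \<le> two_sided_rate x"
      proof cases
        case 1
        then show ?thesis by (auto simp: Psi_eq two_sided_rate_def A.rate_def intro!: SUP_upper)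
      next
        case 2
        then have "ereal (\<theta> * x) - ?P \<theta> \<le> 0"
          by (intro neg) (auto simp: Psi_eq B.cost_nonneg mult_nonpos_nonneg)
        also have "0 \<le> two_sided_rate x" using 2 by (simp add: two_sided_rate_def A.rate_nonneg)
        finally show ?thesis .
      next
        case 3
        then have "ereal (\<theta> * x) - ?P \<theta> \<le> 0"
          by (intro neg) (auto simp: Psi_eq A.cost_nonneg mult_nonneg_nonpos)
        also have "0 \<le> two_sided_rate x" using 3 by (simp add: two_sided_rate_def B.rate_nonneg)
        finally show ?thesis .
      next
        case 4
        have "ereal ((- \<theta>) * (- x)) - B.cost (- \<theta>) \<le> B.rate (- x)"
          unfolding B.rate_def using 4 by (intro SUP_upper) auto
        with 4 show ?thesis by (simp add: Psi_eq two_sided_rate_def)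
      qed
    qed
    show "two_sided_rate x \<le> (SUP \<theta>. ereal (\<theta> * x) - ?P \<theta>)"
    proof (cases "0 \<le> x")
      case True
      have "A.rate x \<le> (SUP \<theta>. ereal (\<theta> * x) - ?P \<theta>)"
        unfolding A.rate_def
      proof (rule SUP_least)
        fix \<theta> :: real assume "\<theta> \<in> {0..}"
        then have "ereal (\<theta> * x) - A.cost \<theta> = ereal (\<theta> * x) - ?P \<theta>" by (simp add: Psi_eq)
        also have "\<dots> \<le> (SUP \<theta>. ereal (\<theta> * x) - ?P \<theta>)" by (intro SUP_upper) simp
        finally show "ereal (\<theta> * x) - A.cost \<theta> \<le> \<dots>" .
      qed
      with True show ?thesis by (simp add: two_sided_rate_def)
    next
      case False
      have "B.rate (- x) \<le> (SUP \<theta>. ereal (\<theta> * x) - ?P \<theta>)"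
        unfolding B.rate_def
      proof (rule SUP_least)
        fix \<theta> :: real assume \<theta>: "\<theta> \<in> {0..}"
        have "ereal (\<theta> * - x) - B.cost \<theta> = ereal ((- \<theta>) * x) - ?P (- \<theta>)"
          using \<theta> by (cases "\<theta> = 0") (auto simp: Psi_eq A.cost_0 B.cost_0)
        also have "\<dots> \<le> (SUP \<theta>. ereal (\<theta> * x) - ?P \<theta>)" by (intro SUP_upper) simp
        finally show "ereal (\<theta> * - x) - B.cost \<theta> \<le> \<dots>" .
      qed
      with False show ?thesis by (simp add: two_sided_rate_def)
    qed
  qed
qed

lemma two_sided_rate_nonneg: "0 \<le> two_sided_rate x"
  by (simp add: two_sided_rate_def A.rate_nonneg B.rate_nonneg)

text \<open>
  Sublevel sets are closed as intersections of sublevel sets of affine functions, and bounded as both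
  summands have some finite exponential moment of positive order.
\<close>

lemma good_rate_function_two_sided_rate: "good_rate_function two_sided_rate"
proof -
  let ?P = "Psi \<nu>1 \<nu>2 (log_mgf M (S1 1)) (log_mgf M (S2 1))"
  have closed: "closed {x. two_sided_rate x \<le> ereal b}" for b
  proof -
    have "{x. two_sided_rate x \<le> ereal b} = (\<Inter>\<theta>. {x. ereal (\<theta> * x) - ?P \<theta> \<le> ereal b})"
      unfolding legendre_eq[symmetric] legendre_transform_def by (auto simp: SUP_le_iff)
    moreover have "closed {x. ereal (\<theta> * x) - ?P \<theta> \<le> ereal b}" for \<theta>
    proof -
      have "0 \<le> ?P \<theta>" by (simp add: Psi_eq A.cost_nonneg B.cost_nonneg)
      then consider r where "?P \<theta> = ereal r" | "?P \<theta> = \<infinity>" by (cases "?P \<theta>") auto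
      then show ?thesis
      proof cases
        case 1
        have "closed {x. \<theta> * x - r \<le> b}" by (intro closed_Collect_le continuous_intros)
        with 1 show ?thesis by simp
      qed simp
    qed
    ultimately show ?thesis by auto
  qed
  obtain \<theta>1 \<xi>1 where 1: "0 < \<theta>1" "A.admissible \<theta>1 \<xi>1" using A.admissible_of_exponential_moment by blast
  obtain \<theta>2 \<xi>2 where 2: "0 < \<theta>2" "B.admissible \<theta>2 \<xi>2" using B.admissible_of_exponential_moment by blast
  have "{x. two_sided_rate x \<le> ereal b} \<subseteq> {- ((b + \<xi>2) / \<theta>2) .. max 0 ((b + \<xi>1) / \<theta>1)} \<union> {0..max 0 ((b + \<xi>1) / \<theta>1)}" for b
  proof
    fix x assume "x \<in> {x. two_sided_rate x \<le> ereal b}"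
    then have x: "two_sided_rate x \<le> ereal b" by simp
    show "x \<in> {- ((b + \<xi>2) / \<theta>2) .. max 0 ((b + \<xi>1) / \<theta>1)} \<union> {0..max 0 ((b + \<xi>1) / \<theta>1)}"
    proof (cases "0 \<le> x")
      case True
      then have "A.rate x \<le> ereal b" using x by (simp add: two_sided_rate_def)
      from order_trans[OF A.rate_ge[OF 1(2)] this] have "\<theta>1 * x - \<xi>1 \<le> b" by simp
      then have "x \<le> (b + \<xi>1) / \<theta>1" using 1 by (simp add: le_divide_eq algebra_simps)
      with True show ?thesis by auto
    next
      case False
      then have "B.rate (- x) \<le> ereal b" using x by (simp add: two_sided_rate_def)
      from order_trans[OF B.rate_ge[OF 2(2)] this] have "\<theta>2 * (- x) - \<xi>2 \<le> b" by simp
      then have "- x \<le> (b + \<xi>2) / \<theta>2" using 2 by (simp add: le_divide_eq algebra_simps)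
      with False show ?thesis by auto
    qed
  qed
  then have "bounded {x. two_sided_rate x \<le> ereal b}" for b
    by (rule bounded_subset[rotated]) (simp add: bounded_closed_interval)
  then show ?thesis
    using closed two_sided_rate_nonneg
    by (auto simp: good_rate_function_def rate_function_def compact_eq_bounded_closed)
qed

text \<open>
  Only the almost sure values of \<open>Z\<close> are known, hence the completion: on it \<open>Z\<close> is measurable and its
  events have the probabilities of those of \<open>average\<close>.
\<close>

lemma satisfies_LDP_two_sided_rate:
  assumes Z_eq: "\<And>t. 0 < t \<Longrightarrow> AE \<omega> in M. Z t \<omega> = average t \<omega>"
  shows "satisfies_LDP (completion M) Z (\<lambda>t. t) two_sided_rate"
proof -
  have ae: "AE \<omega> in completion M. Z t \<omega> = average t \<omega>" if "0 < t" for t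
    using Z_eq[OF that] by (rule AE_completion)
  have Z_measurable: "Z t \<in> borel_measurable (completion M)" if t: "0 < t" for t
  proof (rule measurableI)
    fix B :: "real set" assume B: "B \<in> sets borel"
    have "average t \<in> borel_measurable (completion M)"
      using t by (intro measurable_completion average_measurable) auto
    then have "average t -` B \<inter> space (completion M) \<in> sets (completion M)"
      using B by (rule measurable_sets)
    moreover have "AE \<omega> in completion M. \<omega> \<in> average t -` B \<inter> space (completion M) \<longleftrightarrow> \<omega> \<in> Z t -` B \<inter> space (completion M)"
      using ae[OF t] by eventually_elim simp
    ultimately show "Z t -` B \<inter> space (completion M) \<in> sets (completion M)"
      by (rule completion.in_sets_AE[OF _ _ Int_lower2, rotated])
  qed simp
  have emeasure_Z: "emeasure (completion M) {\<omega> \<in> space (completion M). Z t \<omega> \<in> B} = ennreal (prob {\<omega> \<in> space M. average t \<omega> \<in> B})"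
    if t: "0 < t" and B[measurable]: "B \<in> sets borel" for t B
  proof -
    note [measurable] = Z_measurable[OF t] average_measurable[OF less_imp_le[OF t]]
      measurable_completion[OF average_measurable[OF less_imp_le[OF t]]]
    have "{\<omega> \<in> space (completion M). Z t \<omega> \<in> B} \<in> sets (completion M)"
      "{\<omega> \<in> space (completion M). average t \<omega> \<in> B} \<in> sets (completion M)"
      by measurable
    moreover have "AE \<omega> in completion M. \<omega> \<in> {\<omega> \<in> space (completion M). Z t \<omega> \<in> B}
        \<longleftrightarrow> \<omega> \<in> {\<omega> \<in> space (completion M). average t \<omega> \<in> B}"
      using ae[OF t] by eventually_elim simp
    ultimately have "emeasure (completion M) {\<omega> \<in> space (completion M). Z t \<omega> \<in> B}
        = emeasure (completion M) {\<omega> \<in> space (completion M). average t \<omega> \<in> B}"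
      by (intro emeasure_eq_AE)
    also have "\<dots> = emeasure M {\<omega> \<in> space M. average t \<omega> \<in> B}" by simp
    finally show ?thesis by (simp add: emeasure_eq_measure)
  qed
  have upper: "Limsup at_top (\<lambda>t. ereal (1 / t) * log_ennreal (emeasure (completion M) {\<omega> \<in> space (completion M). Z t \<omega> \<in> C}))
    \<le> - (INF x\<in>C. two_sided_rate x)" if C: "closed C" for C
  proof (rule limsup_log_le)
    show "0 \<le> (INF x\<in>C. two_sided_rate x)" by (intro INF_greatest two_sided_rate_nonneg)
    fix c assume "ereal c < (INF x\<in>C. two_sided_rate x)"
    then have c: "ereal c < two_sided_rate x" if "x \<in> C" for x
      using that by (meson INF_lower less_le_trans)
    have "\<exists>K. \<forall>t>0. prob {\<omega> \<in> space M. average t \<omega> \<in> C} \<le> K * exp (- c * t)"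
    proof (rule prob_closed_le[OF C])
      fix x assume "x \<in> C"
      from c[OF this] show "0 \<le> x \<Longrightarrow> ereal c < A.rate x" "x \<le> 0 \<Longrightarrow> ereal c < B.rate (- x)"
        by (auto simp: two_sided_rate_def A.rate_0 B.rate_0 split: if_splits)
    qed
    then obtain K where K: "\<And>t. 0 < t \<Longrightarrow> prob {\<omega> \<in> space M. average t \<omega> \<in> C} \<le> K * exp (- c * t)"
      by blast
    have "emeasure (completion M) {\<omega> \<in> space (completion M). Z t \<omega> \<in> C} \<le> ennreal (K * exp (- c * t))"
      if "0 < t" for t
      unfolding emeasure_Z[OF that borel_closed[OF C]] by (rule ennreal_leI[OF K[OF that]])
    then show "\<exists>K. \<forall>t>0. emeasure (completion M) {\<omega> \<in> space (completion M). Z t \<omega> \<in> C} \<le> ennreal (K * exp (- c * t))"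
      by blast
  qed
  have lower: "- (INF x\<in>U. two_sided_rate x)
    \<le> Liminf at_top (\<lambda>t. ereal (1 / t) * log_ennreal (emeasure (completion M) {\<omega> \<in> space (completion M). Z t \<omega> \<in> U}))"
    if U: "open U" for U
  proof (rule liminf_log_ge)
    fix c assume "(INF x\<in>U. two_sided_rate x) < ereal c"
    then obtain x where x: "x \<in> U" "two_sided_rate x < ereal c" by (auto simp: INF_less_iff)
    have "eventually (\<lambda>t. exp (- c * t) \<le> prob {\<omega> \<in> space M. average t \<omega> \<in> U}) at_top"
      using x by (intro prob_open_ge[OF U x(1)]) (auto simp: two_sided_rate_def A.rate_0 B.rate_0 split: if_splits)
    then show "eventually (\<lambda>t. ennreal (exp (- c * t)) \<le> emeasure (completion M) {\<omega> \<in> space (completion M). Z t \<omega> \<in> U}) at_top"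
      using eventually_gt_at_top[of 0]
      by eventually_elim (simp only: emeasure_Z[OF _ borel_open[OF U]] ennreal_leI)
  qed
  show ?thesis
    unfolding satisfies_LDP_def
    using Z_measurable upper lower good_rate_function_two_sided_rate
    by (auto simp: good_rate_function_def filterlim_ident)
qed

end

theorem proposition4p1:
  fixes N :: "'b measure" and S :: "real \<Rightarrow> 'b \<Rightarrow> real"
    and M :: "'a measure" and S1 S2 L1 L2 :: "real \<Rightarrow> 'a \<Rightarrow> real"
    and \<nu>1 \<nu>2 :: real
  assumes "0 < \<nu>1" "\<nu>1 < 1" "0 < \<nu>2" "\<nu>2 < 1"
    and "prob_space N"
    and "levy_process N S"
    and "\<exists>\<delta>>0. \<forall>\<theta>. \<bar>\<theta>\<bar> < \<delta> \<longrightarrow> \<bar>log_mgf N (S 1) \<theta>\<bar> \<noteq> \<infinity>"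
    and "bounded_variation_process N S"
    and "\<not> subordinator N S"
    and "prob_space M"
    and "subordinator M S1" "\<not> null_process M S1"
    and "subordinator M S2" "\<not> null_process M S2"
    and "prob_space.indep_var M path_space (sample_path S1) path_space (sample_path S2)"
    and "process_law N S = process_law M (\<lambda>t \<omega>. S1 t \<omega> - S2 t \<omega>)"
    and "inverse_stable_subordinator M \<nu>1 L1"
    and "inverse_stable_subordinator M \<nu>2 L2"
    and "prob_space.indep_var M path_space (sample_path L1) path_space (sample_path L2)"
    and "prob_space.indep_var M
           (path_space \<Otimes>\<^sub>M path_space) (\<lambda>\<omega>. (sample_path L1 \<omega>, sample_path L2 \<omega>))
           (path_space \<Otimes>\<^sub>M path_space) (\<lambda>\<omega>. (sample_path S1 \<omega>, sample_path S2 \<omega>))"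
  defines "J \<equiv> legendre_transform (Psi \<nu>1 \<nu>2 (log_mgf M (S1 1)) (log_mgf M (S2 1)))"
  shows "satisfies_LDP (completion M) (\<lambda>t \<omega>. (S1 (L1 t \<omega>) \<omega> - S2 (L2 t \<omega>) \<omega>) / t) (\<lambda>t. t) J
         \<and> good_rate_function J"
proof -
  interpret prob_space M by fact
  have S_meas: "0 \<le> t \<Longrightarrow> S1 t \<in> borel_measurable M" "0 \<le> t \<Longrightarrow> S2 t \<in> borel_measurable M" for t
    using assms(11,13) by (auto simp: subordinator_def levy_process_def)
  have L_meas: "0 \<le> t \<Longrightarrow> L1 t \<in> borel_measurable M" "0 \<le> t \<Longrightarrow> L2 t \<in> borel_measurable M" for t
  proof -
    assume t: "0 \<le> t"
    have "sample_path L1 \<in> measurable M path_space" "sample_path L2 \<in> measurable M path_space"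
      using indep_var_rv1[OF assms(19)] indep_var_rv2[OF assms(19)] by auto
    from this[THEN measurable_compose, OF path_component_measurable[OF t]]
    show "L1 t \<in> borel_measurable M" "L2 t \<in> borel_measurable M"
      using t by (simp_all add: sample_path_apply)
  qed
  have indep: "(\<integral>\<^sup>+\<omega>. f1 (L1 t \<omega>) * f2 (L2 t \<omega>) * (g1 (S1 r \<omega>) * g2 (S2 s \<omega>)) \<partial>M) =
    (\<integral>\<^sup>+\<omega>. f1 (L1 t \<omega>) \<partial>M) * (\<integral>\<^sup>+\<omega>. f2 (L2 t \<omega>) \<partial>M) *
    ((\<integral>\<^sup>+\<omega>. g1 (S1 r \<omega>) \<partial>M) * (\<integral>\<^sup>+\<omega>. g2 (S2 s \<omega>) \<partial>M))"
    if "0 \<le> t" "0 \<le> r" "0 \<le> s" "f1 \<in> borel_measurable borel" "f2 \<in> borel_measurable borel"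
      "g1 \<in> borel_measurable borel" "g2 \<in> borel_measurable borel"
    for t r s and f1 f2 g1 g2 :: "real \<Rightarrow> ennreal"
    by (rule nn_integral_paths_indep[OF assms(15,19,20) that])
  obtain \<delta> where \<delta>: "0 < \<delta>" "\<And>\<theta>. \<bar>\<theta>\<bar> < \<delta> \<Longrightarrow> \<bar>log_mgf N (S 1) \<theta>\<bar> \<noteq> \<infinity>"
    using assms(7) by blast
  (* The moment generating function of S 1 depends on its law only and is thus that of S1 1 - S2 1. *)
  have finite: "(\<integral>\<^sup>+\<omega>. ennreal (exp (\<theta> * (S1 1 \<omega> - S2 1 \<omega>))) \<partial>M) < \<infinity>" if "\<bar>\<theta>\<bar> < \<delta>" for \<theta>
  proof -
    have "(\<integral>\<^sup>+\<omega>. ennreal (exp (\<theta> * S 1 \<omega>)) \<partial>N) = (\<integral>\<^sup>+\<omega>. ennreal (exp (\<theta> * (S1 1 \<omega> - S2 1 \<omega>))) \<partial>M)"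
    proof -
      have "(\<integral>\<^sup>+p. ennreal (exp (\<theta> * p 1)) \<partial>process_law N S) = (\<integral>\<^sup>+\<omega>. ennreal (exp (\<theta> * S 1 \<omega>)) \<partial>N)"
        using assms(6) by (intro nn_integral_process_law) (auto simp: levy_process_def)
      moreover have "(\<integral>\<^sup>+p. ennreal (exp (\<theta> * p 1)) \<partial>process_law M (\<lambda>t \<omega>. S1 t \<omega> - S2 t \<omega>))
          = (\<integral>\<^sup>+\<omega>. ennreal (exp (\<theta> * (S1 1 \<omega> - S2 1 \<omega>))) \<partial>M)"
        using S_meas by (intro nn_integral_process_law) auto
      ultimately show ?thesis using assms(16) by simp
    qed
    moreover have "(\<integral>\<^sup>+\<omega>. ennreal (exp (\<theta> * S 1 \<omega>)) \<partial>N) \<noteq> \<infinity>"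
      using \<delta>(2)[OF that] by (auto simp: log_mgf_def log_ennreal_def)
    ultimately show ?thesis by (simp add: less_top)
  qed
  have indep_S: "(\<integral>\<^sup>+\<omega>. g1 (S1 1 \<omega>) * g2 (S2 1 \<omega>) \<partial>M) = (\<integral>\<^sup>+\<omega>. g1 (S1 1 \<omega>) \<partial>M) * (\<integral>\<^sup>+\<omega>. g2 (S2 1 \<omega>) \<partial>M)"
    if "g1 \<in> borel_measurable borel" "g2 \<in> borel_measurable borel" for g1 g2 :: "real \<Rightarrow> ennreal"
    using indep[of 0 1 1 "\<lambda>_. 1" "\<lambda>_. 1" g1 g2] that by (simp add: emeasure_space_1)
  have moment1: "\<exists>\<theta>>0. (\<integral>\<^sup>+\<omega>. ennreal (exp (\<theta> * S1 1 \<omega>)) \<partial>M) < \<infinity>"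
  proof (intro exI conjI)
    show "0 < \<delta> / 2" using \<delta> by simp
    show "(\<integral>\<^sup>+\<omega>. ennreal (exp (\<delta> / 2 * S1 1 \<omega>)) \<partial>M) < \<infinity>"
    proof (rule exponential_moment_of_difference[where b = "- \<delta> / 2" and Y = "S2 1"])
      show "(\<integral>\<^sup>+\<omega>. ennreal (exp (\<delta> / 2 * S1 1 \<omega> + - \<delta> / 2 * S2 1 \<omega>)) \<partial>M) < \<infinity>"
        using finite[of "\<delta> / 2"] \<delta> by (simp add: algebra_simps)
    qed (use S_meas in simp, intro indep_S, auto)
  qed
  have moment2: "\<exists>\<theta>>0. (\<integral>\<^sup>+\<omega>. ennreal (exp (\<theta> * S2 1 \<omega>)) \<partial>M) < \<infinity>"
  proof (intro exI conjI)
    show "0 < \<delta> / 2" using \<delta> by simp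
    show "(\<integral>\<^sup>+\<omega>. ennreal (exp (\<delta> / 2 * S2 1 \<omega>)) \<partial>M) < \<infinity>"
    proof (rule exponential_moment_of_difference[where b = "- \<delta> / 2" and Y = "S1 1"])
      show "(\<integral>\<^sup>+\<omega>. ennreal (exp (\<delta> / 2 * S2 1 \<omega> + - \<delta> / 2 * S1 1 \<omega>)) \<partial>M) < \<infinity>"
        using finite[of "- \<delta> / 2"] \<delta> by (simp add: algebra_simps)
      show "(\<integral>\<^sup>+\<omega>. ennreal (exp (\<delta> / 2 * S2 1 \<omega>)) * ennreal (exp (- \<delta> / 2 * S1 1 \<omega>)) \<partial>M)
        = (\<integral>\<^sup>+\<omega>. ennreal (exp (\<delta> / 2 * S2 1 \<omega>)) \<partial>M) * (\<integral>\<^sup>+\<omega>. ennreal (exp (- \<delta> / 2 * S1 1 \<omega>)) \<partial>M)"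
        using indep_S[of "\<lambda>x. ennreal (exp (- \<delta> / 2 * x))" "\<lambda>x. ennreal (exp (\<delta> / 2 * x))"]
        by (simp add: mult.commute)
    qed (use S_meas in simp)
  qed
  obtain H1 where H1: "stable_subordinator M \<nu>1 H1" "AE \<omega> in M. \<forall>t\<ge>0. L1 t \<omega> = Inf {u. 0 \<le> u \<and> H1 u \<omega> > t}"
    using assms(17) by (auto simp: inverse_stable_subordinator_def)
  obtain H2 where H2: "stable_subordinator M \<nu>2 H2" "AE \<omega> in M. \<forall>t\<ge>0. L2 t \<omega> = Inf {u. 0 \<le> u \<and> H2 u \<omega> > t}"
    using assms(18) by (auto simp: inverse_stable_subordinator_def)
  interpret A: time_changed_subordinator M S1 H1 L1 \<nu>1
    by unfold_locales (fact assms H1 L_meas moment1)+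
  interpret B: time_changed_subordinator M S2 H2 L2 \<nu>2
    by unfold_locales (fact assms H2 L_meas moment2)+
  interpret two_sided_time_change M S1 H1 L1 \<nu>1 S2 H2 L2 \<nu>2
  proof unfold_locales
    fix t :: real and n m and f1 f2 g1 g2 :: "real \<Rightarrow> ennreal"
    assume "0 \<le> t" and meas: "f1 \<in> borel_measurable borel" "f2 \<in> borel_measurable borel"
      "g1 \<in> borel_measurable borel" "g2 \<in> borel_measurable borel"
    from indep[OF this(1) of_nat_0_le_iff of_nat_0_le_iff meas]
    show "(\<integral>\<^sup>+\<omega>. f1 (L1 t \<omega>) * f2 (L2 t \<omega>) * (g1 (S1 (real n) \<omega>) * g2 (S2 (real m) \<omega>)) \<partial>M) =
      (\<integral>\<^sup>+\<omega>. f1 (L1 t \<omega>) \<partial>M) * (\<integral>\<^sup>+\<omega>. f2 (L2 t \<omega>) \<partial>M) *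
      ((\<integral>\<^sup>+\<omega>. g1 (S1 (real n) \<omega>) \<partial>M) * (\<integral>\<^sup>+\<omega>. g2 (S2 (real m) \<omega>) \<partial>M))" .
  qed
  have "AE \<omega> in M. (S1 (L1 t \<omega>) \<omega> - S2 (L2 t \<omega>) \<omega>) / t = average t \<omega>" if "0 < t" for t
    using A.time_change_eq[OF less_imp_le[OF that]] B.time_change_eq[OF less_imp_le[OF that]]
    by eventually_elim (simp add: average_def)
  then have "satisfies_LDP (completion M) (\<lambda>t \<omega>. (S1 (L1 t \<omega>) \<omega> - S2 (L2 t \<omega>) \<omega>) / t) (\<lambda>t. t) two_sided_rate"
    by (rule satisfies_LDP_two_sided_rate)
  with good_rate_function_two_sided_rate show ?thesis
    unfolding J_def legendre_eq by simp
qed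

end
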